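(* There exists an absolute constant $c>0$ such that the following holds for all sufficiently large $n$. Let $S_1$ and $S_2$ be collections of closed curves in the plane such that $S_1\cup S_2$ is in general position, $|S_1|=|S_2|=n$, any two elements of $S_1\cup S_2$ intersect, and every element of $S_1$ touches every element of $S_2$. Then the number of crossing points between pairs of elements of $S_1$, or the number of crossing points between pairs of elements of $S_2$, is at least $c\,n^2\sqrt{\log n/\log\log n}$.
   Context: Closed curves are simple closed (Jordan) curves in the plane. A family of curves is in general position if no three curves pass through the same point and no two curves share infinitely many points. Two curves touch if they have precisely one point in common, at which they do not properly cross; this point is a touching point. All other common points of two curves are crossing points. Two curves intersect if they have at least one common point. *)

theory Defs
  imports "HOL-Analysis.Analysis"
begin

text \<open>Curves are point sets in the plane, identified with \<open>complex\<close>.\<close>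

definition closed_curve :: "complex set \<Rightarrow> bool" where
  "closed_curve A \<longleftrightarrow> (\<exists>g. simple_path g \<and> pathfinish g = pathstart g \<and> path_image g = A)"

definition general_position :: "complex set set \<Rightarrow> bool" where
  "general_position S \<longleftrightarrow>
     (\<forall>A\<in>S. \<forall>B\<in>S. \<forall>C\<in>S. A \<noteq> B \<and> A \<noteq> C \<and> B \<noteq> C \<longrightarrow> A \<inter> B \<inter> C = {}) \<and>
     (\<forall>A\<in>S. \<forall>B\<in>S. A \<noteq> B \<longrightarrow> finite (A \<inter> B))"

text \<open>\<open>B\<close> passes at \<open>p\<close> from one side of the Jordan curve \<open>A\<close> to the other. Since \<open>B\<close> is closed,
  it can be parametrized so that \<open>p\<close> is at parameter \<open>1/2\<close>, and the direction of traversal can be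
  reversed, so it suffices to speak of passing from the inside to the outside.\<close>

definition properly_cross_at :: "complex \<Rightarrow> complex set \<Rightarrow> complex set \<Rightarrow> bool" where
  "properly_cross_at p A B \<longleftrightarrow>
     p \<in> A \<inter> B \<and>
     (\<exists>g \<epsilon>. simple_path g \<and> pathfinish g = pathstart g \<and> path_image g = B \<and> g (1/2) = p \<and>
        0 < \<epsilon> \<and> \<epsilon> \<le> 1/2 \<and>
        g ` {1/2 - \<epsilon> <..< 1/2} \<subseteq> inside A \<and> g ` {1/2 <..< 1/2 + \<epsilon>} \<subseteq> outside A)"

definition touching_points :: "complex set \<Rightarrow> complex set \<Rightarrow> complex set" where
  "touching_points A B = {p. A \<inter> B = {p} \<and> \<not> properly_cross_at p A B}"

definition touch :: "complex set \<Rightarrow> complex set \<Rightarrow> bool" where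
  "touch A B \<longleftrightarrow> (\<exists>p. A \<inter> B = {p} \<and> \<not> properly_cross_at p A B)"

definition crossing_points :: "complex set \<Rightarrow> complex set \<Rightarrow> complex set" where
  "crossing_points A B = (A \<inter> B) - touching_points A B"

text \<open>In general position a point lies on at most two of the curves, so counting points is the same
  as counting crossings pair by pair.\<close>

definition crossings :: "complex set set \<Rightarrow> complex set" where
  "crossings S = (\<Union>A\<in>S. \<Union>B\<in>S - {A}. crossing_points A B)"

end

theory Submission
  imports Defs "HOL-Real_Asymp.Real_Asymp"
begin

text \<open>
  Two curves with a single common point lie on one side of each other, so cutting the plane along the
  curves of \<open>S1\<close> one crosscut after the other produces a Jordan curve \<open>\<Gamma>\<close> that contains all touching
  points and has the curves of \<open>S2\<close> on one side and those of \<open>S1\<close> on the other. (Cutting can only get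
  stuck if all curves of \<open>S1\<close> touch pairwise, which is impossible for five curves, by a
  nonplanarity argument for the complete graph on five vertices.)

  Read the \<open>n\<^sup>2\<close> touching points along \<open>\<Gamma>\<close>. Two curves on the same side of \<open>\<Gamma>\<close> whose touching
  points alternate \<open>k\<close> times have at least about \<open>k / 2\<close> common points, since disjoint chords of \<open>\<Gamma>\<close>
  do not interlace. It remains to bound the number of alternations in a sequence that runs through all
  pairs in \<open>S1 \<times> S2\<close>. Among any \<open>(2 m)\<^sup>2\<close> consecutive pairs, \<open>2 m\<close> distinct curves of one of the
  families occur, and at least \<open>m\<close> of their first occurrences come after \<open>m\<close> other curves have
  been seen since the previous occurrence. So there are at least \<open>n\<^sup>2 / (8 m)\<close> such positions for every
  \<open>m \<le> n / 2\<close>, and summing over \<open>m\<close> yields order \<open>n\<^sup>2 log n\<close> alternations.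
\<close>

section \<open>Sequences running through all pairs\<close>

text \<open>A pair of a position \<open>t\<close> and a label \<open>y\<close> in
  \<open>seen_since r t\<close> is an alternation: an occurrence of \<open>r t\<close> such that
  \<open>y\<close> occurred after the previous occurrence of \<open>r t\<close>. If
  \<open>r t\<close> has not occurred before, all earlier labels count.\<close>

definition seen_since :: "(nat \<Rightarrow> 'a) \<Rightarrow> nat \<Rightarrow> 'a set" where
  "seen_since r t = {y. y \<noteq> r t \<and> (\<exists>q<t. r q = y \<and> (\<forall>s. q < s \<and> s < t \<longrightarrow> r s \<noteq> r t))}"

lemma seen_since_subset: "seen_since r t \<subseteq> r ` {..<t}"
  by (auto simp: seen_since_def)

lemma finite_seen_since [simp]: "finite (seen_since r t)"
  using seen_since_subset by (rule finite_subset) simp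

lemma window_subset_seen_since:
  assumes "r t \<notin> r ` {a..<t}"
  shows "r ` {a..<t} \<subseteq> seen_since r t"
proof
  fix y assume y: "y \<in> r ` {a..<t}"
  then obtain q where q: "a \<le> q" "q < t" "y = r q" by auto
  have "r s \<noteq> r t" if "q < s \<and> s < t" for s
  proof
    assume "r s = r t"
    moreover have "s \<in> {a..<t}" using q that by auto
    ultimately show False using assms by (metis imageI)
  qed
  moreover have "y \<noteq> r t" using y assms by blast
  ultimately show "y \<in> seen_since r t"
    unfolding seen_since_def using q by blast
qed

text \<open>Consider the first occurrence of each label inside the window. The label was absent from
  the window so far, so every label already shown by the window lies in its
  \<open>seen_since\<close> set. Hence only the first \<open>m\<close> new labels can fail to reach
  level \<open>m\<close>.\<close>

lemma window_count:
  assumes "a \<le> e"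
  shows "card (r ` {a..<e}) \<le> card {t \<in> {a..<e}. m \<le> card (seen_since r t)} + m"
  using assms
proof (induction e rule: dec_induct)
  case base
  then show ?case by simp
next
  case (step e)
  let ?C = "\<lambda>e. {t \<in> {a..<e}. m \<le> card (seen_since r t)}"
  have img: "r ` {a..<Suc e} = insert (r e) (r ` {a..<e})"
    using step by (simp add: atLeastLessThanSuc)
  have mono: "card (?C e) \<le> card (?C (Suc e))"
    by (rule card_mono) auto
  show ?case
  proof (cases "r e \<in> r ` {a..<e}")
    case True
    then show ?thesis using img mono step.IH by (simp add: insert_absorb)
  next
    case False
    have c: "card (r ` {a..<Suc e}) = Suc (card (r ` {a..<e}))"
      using False img by simp
    show ?thesis
    proof (cases "m \<le> card (r ` {a..<e})")
      case True
      have "m \<le> card (seen_since r e)"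
        using True card_mono[OF finite_seen_since window_subset_seen_since[OF False]] by linarith
      then have "?C (Suc e) = insert e (?C e)"
        using step by (auto simp: less_Suc_eq)
      then have "card (?C (Suc e)) = Suc (card (?C e))" by simp
      then show ?thesis using c step.IH by simp
    next
      case False
      then show ?thesis using c by simp
    qed
  qed
qed

text \<open>A window of \<open>(2 * m)\<^sup>2\<close> distinct pairs shows at least \<open>2 * m\<close> distinct entries in one of the
  two coordinates.\<close>

lemma two_sequences_windows:
  fixes r :: "nat \<Rightarrow> 'a" and b :: "nat \<Rightarrow> 'b"
  assumes inj: "inj_on (\<lambda>t. (r t, b t)) {..<N}" and "w * (2 * m)\<^sup>2 \<le> N"
  shows "m * w \<le> card {t \<in> {..<w * (2 * m)\<^sup>2}. m \<le> card (seen_since r t)}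
               + card {t \<in> {..<w * (2 * m)\<^sup>2}. m \<le> card (seen_since b t)}"
  using assms(2)
proof (induction w)
  case 0
  then show ?case by simp
next
  case (Suc w)
  define a e where "a = w * (2 * m)\<^sup>2" and "e = Suc w * (2 * m)\<^sup>2"
  have ae: "a \<le> e" "e - a = (2 * m)\<^sup>2" "e \<le> N"
    using Suc.prems by (auto simp: a_def e_def)
  have "2 * m \<le> card (r ` {a..<e}) \<or> 2 * m \<le> card (b ` {a..<e})"
  proof (rule ccontr)
    assume "\<not> ?thesis"
    then have lt: "card (r ` {a..<e}) < 2 * m" "card (b ` {a..<e}) < 2 * m" by auto
    have "inj_on (\<lambda>t. (r t, b t)) {a..<e}"
      by (rule inj_on_subset[OF inj]) (use ae in auto)
    then have "(2 * m)\<^sup>2 = card ((\<lambda>t. (r t, b t)) ` {a..<e})"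
      using ae by (simp add: card_image)
    also have "\<dots> \<le> card (r ` {a..<e} \<times> b ` {a..<e})"
      by (rule card_mono) auto
    also have "\<dots> = card (r ` {a..<e}) * card (b ` {a..<e})"
      by (rule card_cartesian_product)
    also have "\<dots> < (2 * m) * (2 * m)"
      using lt by (intro mult_strict_mono) auto
    finally show False by (simp add: power2_eq_square)
  qed
  \<comment> \<open>A coordinate showing \<open>2 * m\<close> labels loses at most \<open>m\<close>
    of them in \<open>window_count\<close>, so \<open>m\<close> positions of level \<open>m\<close>
    remain.\<close>
  then have "m \<le> card {t \<in> {a..<e}. m \<le> card (seen_since r t)}
               + card {t \<in> {a..<e}. m \<le> card (seen_since b t)}"
    using window_count[OF ae(1), of r m] window_count[OF ae(1), of b m] by linarith
  moreover have split: "card {t \<in> {..<e}. P t} = card {t \<in> {..<a}. P t} + card {t \<in> {a..<e}. P t}"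
    for P :: "nat \<Rightarrow> bool"
  proof -
    have "{t \<in> {..<e}. P t} = {t \<in> {..<a}. P t} \<union> {t \<in> {a..<e}. P t}"
      using ae(1) by auto
    moreover have "card ({t \<in> {..<a}. P t} \<union> {t \<in> {a..<e}. P t})
        = card {t \<in> {..<a}. P t} + card {t \<in> {a..<e}. P t}"
      by (rule card_Un_disjoint) auto
    ultimately show ?thesis by simp
  qed
  moreover have "m * w \<le> card {t \<in> {..<a}. m \<le> card (seen_since r t)}
               + card {t \<in> {..<a}. m \<le> card (seen_since b t)}"
    using Suc by (simp add: a_def)
  ultimately show ?case
    unfolding e_def[symmetric] split by simp
qed

text \<open>Layer-cake summation: \<open>f t\<close> is the number of levels
  \<open>m \<ge> 1\<close> that \<open>t\<close> reaches; cutting off at \<open>M\<close> can only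
  lose some.\<close>

lemma sum_ge_sum_card_levels:
  fixes f :: "'a \<Rightarrow> nat"
  assumes "finite T"
  shows "(\<Sum>m=1..M. card {t \<in> T. m \<le> f t}) \<le> (\<Sum>t\<in>T. f t)"
proof -
  have "(\<Sum>m=1..M. card {t \<in> T. m \<le> f t}) = (\<Sum>m=1..M. \<Sum>t\<in>T. if m \<le> f t then 1 else 0)"
    using assms by (simp add: sum.If_cases Int_def)
  also have "\<dots> = (\<Sum>t\<in>T. \<Sum>m=1..M. if m \<le> f t then 1 else 0)"
    by (rule sum.swap)
  also have "\<dots> \<le> (\<Sum>t\<in>T. f t)"
  proof (rule sum_mono)
    fix t
    have "(\<Sum>m=1..M. if m \<le> f t then 1 else (0::nat)) = card ({1..M} \<inter> {m. m \<le> f t})"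
      by (simp add: sum.If_cases)
    also have "\<dots> \<le> card {1..f t}"
      by (rule card_mono) auto
    finally show "(\<Sum>m=1..M. if m \<le> f t then 1 else 0) \<le> f t" by simp
  qed
  finally show ?thesis .
qed

text \<open>Level \<open>m\<close> is reached at least N/(8m) times, with N = n^2. Summing over all
  levels up to n/2 turns these bounds into a harmonic sum, which is the source of the
  logarithm.\<close>

theorem sum_seen_since_ge:
  fixes r :: "nat \<Rightarrow> 'a" and b :: "nat \<Rightarrow> 'b"
  assumes inj: "inj_on (\<lambda>t. (r t, b t)) {..<n\<^sup>2}" and "n > 0"
  shows "real (n\<^sup>2) / 8 * ln (real n / 2)
    \<le> real ((\<Sum>t<n\<^sup>2. card (seen_since r t)) + (\<Sum>t<n\<^sup>2. card (seen_since b t)))"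
proof -
  define N M where "N = n\<^sup>2" and "M = n div 2"
  let ?c = "\<lambda>m. card {t \<in> {..<N}. m \<le> card (seen_since r t)} + card {t \<in> {..<N}. m \<le> card (seen_since b t)}"
  have level: "real N / (8 * real m) \<le> real (?c m)" if m: "m \<in> {1..M}" for m
  proof -
    define w where "w = N div (2 * m)\<^sup>2"
    have m0: "m > 0" and "2 * m \<le> n" using m by (auto simp: M_def)
    then have le: "(2 * m)\<^sup>2 \<le> N" unfolding N_def by (intro power_mono) auto
    have w: "w * (2 * m)\<^sup>2 \<le> N" by (simp add: w_def)
    \<comment> \<open>At least one full window fits, so rounding the number of windows down costs at
      most a factor 2; together with the window length 4m^2 this gives the 8.\<close>
    have "w \<ge> 1" unfolding w_def using le m0 by (simp add: div_greater_zero_iff Suc_le_eq)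
    have "N < Suc w * (2 * m)\<^sup>2"
      unfolding w_def using m0 by (simp add: dividend_less_div_times add.commute)
    also have "\<dots> \<le> (2 * w) * (2 * m)\<^sup>2" using \<open>w \<ge> 1\<close> by (intro mult_right_mono) auto
    finally have "real N \<le> real ((2 * w) * (2 * m)\<^sup>2)" by linarith
    then have "real N \<le> 8 * real m * (real m * real w)" by (simp add: power2_eq_square algebra_simps)
    then have "real N / (8 * real m) \<le> real (m * w)" using m0 by (simp add: field_simps)
    also have "m * w \<le> card {t \<in> {..<w * (2 * m)\<^sup>2}. m \<le> card (seen_since r t)}
               + card {t \<in> {..<w * (2 * m)\<^sup>2}. m \<le> card (seen_since b t)}"
      using two_sequences_windows[OF inj] w unfolding N_def by blast
    also have "\<dots> \<le> ?c m"
      using w by (intro add_mono card_mono) auto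
    finally show ?thesis by simp
  qed
  have "real N / 8 * ln (real n / 2) \<le> real N / 8 * harm M"
  proof (rule mult_left_mono)
    have "real n / 2 \<le> real M + 1" unfolding M_def by linarith
    then have "ln (real n / 2) \<le> ln (real M + 1)" using \<open>n > 0\<close> by simp
    also have "\<dots> \<le> harm M" by (rule ln_le_harm)
    finally show "ln (real n / 2) \<le> harm M" .
  qed simp
  also have "\<dots> = (\<Sum>m=1..M. real N / (8 * real m))"
    by (simp add: harm_def sum_distrib_left field_simps)
  also have "\<dots> \<le> (\<Sum>m=1..M. real (?c m))"
    using level by (intro sum_mono) auto
  also have "\<dots> = real ((\<Sum>m=1..M. card {t \<in> {..<N}. m \<le> card (seen_since r t)})
                  + (\<Sum>m=1..M. card {t \<in> {..<N}. m \<le> card (seen_since b t)}))"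
    by (simp add: sum.distrib)
  also have "\<dots> \<le> real ((\<Sum>t<N. card (seen_since r t)) + (\<Sum>t<N. card (seen_since b t)))"
    unfolding of_nat_le_iff by (intro add_mono sum_ge_sum_card_levels) auto
  finally show ?thesis by (simp add: N_def)
qed

text \<open>Double counting of the alternations, grouped by the ordered pair of labels involved. In
  this form the geometric bound for two curves applies to each summand.\<close>

lemma sum_card_seen_since_by_pairs:
  assumes "finite S" and "\<And>t. t < N \<Longrightarrow> r t \<in> S"
  shows "(\<Sum>t<N. card (seen_since r t))
    = (\<Sum>x\<in>S. \<Sum>y\<in>S - {x}. card {t \<in> {..<N}. r t = x \<and> y \<in> seen_since r t})"
proof -
  have "(\<Sum>x\<in>S. \<Sum>y\<in>S - {x}. card {t \<in> {..<N}. r t = x \<and> y \<in> seen_since r t})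
      = (\<Sum>x\<in>S. \<Sum>y\<in>S - {x}. \<Sum>t<N. if r t = x \<and> y \<in> seen_since r t then 1 else 0)"
    by (simp add: sum.If_cases Int_def)
  also have "\<dots> = (\<Sum>x\<in>S. \<Sum>t<N. \<Sum>y\<in>S - {x}. if r t = x \<and> y \<in> seen_since r t then 1 else 0)"
    by (intro sum.cong refl sum.swap)
  also have "\<dots> = (\<Sum>t<N. \<Sum>x\<in>S. \<Sum>y\<in>S - {x}. if r t = x \<and> y \<in> seen_since r t then 1 else 0)"
    by (rule sum.swap)
  also have "\<dots> = (\<Sum>t<N. card (seen_since r t))"
  proof (rule sum.cong[OF refl])
    fix t assume t: "t \<in> {..<N}"
    have sub: "seen_since r t \<subseteq> S - {r t}"
      using assms(2) t by (auto simp: seen_since_def)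
    have "(\<Sum>x\<in>S. \<Sum>y\<in>S - {x}. if r t = x \<and> y \<in> seen_since r t then 1 else (0::nat))
        = (\<Sum>x\<in>S. if r t = x then \<Sum>y\<in>S - {x}. if y \<in> seen_since r t then 1 else 0 else 0)"
      by (intro sum.cong refl) auto
    also have "\<dots> = (\<Sum>y\<in>S - {r t}. if y \<in> seen_since r t then 1 else 0)"
      using assms t by (simp add: sum.delta)
    also have "\<dots> = card ((S - {r t}) \<inter> seen_since r t)"
      using assms(1) by (simp add: sum.If_cases)
    also have "(S - {r t}) \<inter> seen_since r t = seen_since r t"
      using sub by blast
    finally show "(\<Sum>x\<in>S. \<Sum>y\<in>S - {x}. if r t = x \<and> y \<in> seen_since r t then 1 else 0)
        = card (seen_since r t)" .
  qed
  finally show ?thesis by simp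
qed

section \<open>Chords of a Jordan curve\<close>

lemma simple_path_eqD:
  assumes "simple_path g" "g s = g t" "0 \<le> s" "s < 1" "0 \<le> t" "t < 1"
  shows "s = t"
  using assms unfolding simple_path_def loop_free_def by force

lemma simple_path_interior_eqD:
  assumes "simple_path g" "g s = g t" "0 < s" "s < 1" "0 \<le> t" "t \<le> 1"
  shows "s = t"
  using assms unfolding simple_path_def loop_free_def by force

lemma closed_curveI:
  "simple_path g \<Longrightarrow> pathfinish g = pathstart g \<Longrightarrow> closed_curve (path_image g)"
  by (auto simp: closed_curve_def)

lemma closed_curve_Jordan:
  assumes "closed_curve A"
  shows "compact A" "connected A" "open (inside A)" "open (outside A)" "connected (inside A)"
    "connected (outside A)" "inside A \<noteq> {}" "frontier (inside A) = A" "closed (A \<union> inside A)"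
proof -
  obtain g where g: "simple_path g" "pathfinish g = pathstart g" "path_image g = A"
    using assms by (auto simp: closed_curve_def)
  note J = Jordan_inside_outside[OF g(1,2), unfolded g(3)]
  show "compact A" "connected A"
    using g compact_simple_path_image connected_simple_path_image by blast+
  show "open (inside A)" "open (outside A)" "connected (inside A)"
    "connected (outside A)" "inside A \<noteq> {}" "frontier (inside A) = A"
    using J by auto
  then show "closed (A \<union> inside A)"
    using \<open>compact A\<close> by (metis closed_path_image_Un_inside g(1,3) simple_path_imp_path)
qed

lemma closed_curve_closed: "closed_curve A \<Longrightarrow> closed A"
  using closed_curve_Jordan(1) compact_imp_closed by blast

lemma closed_curve_startE:
  assumes "closed_curve A" "p \<in> A"
  obtains g where "simple_path g" "pathfinish g = pathstart g" "path_image g = A" "g 0 = p" "g 1 = p"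
proof -
  obtain h where h: "simple_path h" "pathfinish h = pathstart h" "path_image h = A"
    using assms by (auto simp: closed_curve_def)
  then obtain a where a: "a \<in> {0..1}" "h a = p"
    using assms(2) by (auto simp: path_image_def)
  show ?thesis
  proof
    show "simple_path (shiftpath a h)" using h a by (simp add: simple_path_shiftpath)
    show "pathfinish (shiftpath a h) = pathstart (shiftpath a h)"
      using h a closed_shiftpath by blast
    show "path_image (shiftpath a h) = A" using h a path_image_shiftpath by blast
    show "shiftpath a h 0 = p" "shiftpath a h 1 = p"
      using endpoints_shiftpath[OF h(2) a(1)] a(2) by (auto simp: pathstart_def pathfinish_def)
  qed
qed

lemma closed_curve_delete_connected:
  assumes "closed_curve A"
  shows "connected (A - {p})"
proof (cases "p \<in> A")
  case True
  obtain g where g: "simple_path g" "pathfinish g = pathstart g" "path_image g = A" "g 0 = p" "g 1 = p"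
    using closed_curve_startE[OF assms True] .
  then show ?thesis
    using connected_simple_path_endless[OF g(1)] by (simp add: pathstart_def pathfinish_def)
next
  case False
  then show ?thesis using closed_curve_Jordan(2)[OF assms] by simp
qed

lemma closed_curve_splitE:
  assumes "closed_curve A" "a \<in> A" "b \<in> A" "a \<noteq> b"
  obtains c1 c2 where "arc c1" "pathstart c1 = a" "pathfinish c1 = b"
    "arc c2" "pathstart c2 = a" "pathfinish c2 = b"
    "path_image c1 \<union> path_image c2 = A" "path_image c1 \<inter> path_image c2 = {a, b}"
proof -
  obtain g where g: "simple_path g" "pathfinish g = pathstart g" "path_image g = A" "g 0 = a" "g 1 = a"
    using closed_curve_startE[OF assms(1,2)] .
  obtain u where u: "u \<in> {0..1}" "g u = b" using g assms(3) by (auto simp: path_image_def)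
  have u01: "0 < u" "u < 1" using u g assms(4) by (force simp: order_le_less)+
  \<comment> \<open>The second arc is traversed backwards from parameter 1, so that both arcs start
    at \<open>a\<close> and finish at \<open>b\<close>.\<close>
  have im1: "path_image (subpath 0 u g) = g ` {0..u}" and im2: "path_image (subpath 1 u g) = g ` {u..1}"
    using u01 by (auto simp: path_image_subpath)
  show ?thesis
  proof
    show "arc (subpath 0 u g)" "arc (subpath 1 u g)"
      using g u u01 assms(4) by (auto intro!: arc_simple_path_subpath)
    show "path_image (subpath 0 u g) \<union> path_image (subpath 1 u g) = A"
      unfolding im1 im2 image_Un[symmetric] using u01 g(3) by (auto simp: path_image_def ivl_disj_un)
    show "path_image (subpath 0 u g) \<inter> path_image (subpath 1 u g) = {a, b}" (is "?L = _")
    proof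
      show "?L \<subseteq> {a, b}"
      proof
        fix x assume "x \<in> ?L"
        then obtain s t where st: "x = g s" "x = g t" "0 \<le> s" "s \<le> u" "u \<le> t" "t \<le> 1"
          unfolding im1 im2 by (elim IntE imageE) auto
        show "x \<in> {a, b}"
        proof (cases "t = 1")
          case False
          then have "s = t" using simple_path_eqD[OF g(1), of s t] st u01 by auto
          then show ?thesis using st u by auto
        qed (use st g in auto)
      qed
      show "{a, b} \<subseteq> ?L"
      proof -
        have "g 0 \<in> g ` {0..u}" "g u \<in> g ` {0..u}" "g 1 \<in> g ` {u..1}" "g u \<in> g ` {u..1}"
          using u01 by auto
        then show ?thesis unfolding im1 im2 using u g(4,5) by auto
      qed
    qed
  qed (use g u in auto)
qed

lemma closed_curve_join:
  assumes "arc c1" "pathstart c1 = a" "pathfinish c1 = b"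
    "arc c2" "pathstart c2 = a" "pathfinish c2 = b"
    "path_image c1 \<inter> path_image c2 = {a, b}"
  shows "closed_curve (path_image c1 \<union> path_image c2)"
proof -
  have "simple_path (c1 +++ reversepath c2)"
    using assms by (intro simple_path_join_loop) (auto simp: arc_reversepath)
  moreover have "path_image (c1 +++ reversepath c2) = path_image c1 \<union> path_image c2"
    using assms by (simp add: path_image_join)
  ultimately show ?thesis
    using closed_curveI[of "c1 +++ reversepath c2"] assms by simp
qed

text \<open>A crosscut divides the disc bounded by a Jordan curve into two discs (theta curve). The
  closed discs share only the crosscut, so a connected set that avoids the crosscut is trapped in
  one of them.\<close>

lemma theta_split:
  fixes c :: "real \<Rightarrow> complex"
  assumes c1: "arc c1" "pathstart c1 = a" "pathfinish c1 = b"
    and c2: "arc c2" "pathstart c2 = a" "pathfinish c2 = b"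
    and c: "arc c" "pathstart c = a" "pathfinish c = b"
    and c12: "path_image c1 \<inter> path_image c2 = {a, b}"
    and crosscut: "path_image c - {a, b} \<subseteq> inside (path_image c1 \<union> path_image c2)"
  defines "G1 \<equiv> path_image c1 \<union> path_image c" and "G2 \<equiv> path_image c2 \<union> path_image c"
    and "G \<equiv> path_image c1 \<union> path_image c2"
  shows "closed_curve G1" "closed_curve G2"
    and "inside G1 \<subseteq> inside G" "inside G2 \<subseteq> inside G"
    and "(G1 \<union> inside G1) \<inter> (G2 \<union> inside G2) = path_image c"
    and "\<And>Q. connected Q \<Longrightarrow> Q \<subseteq> G \<union> inside G \<Longrightarrow> Q \<inter> path_image c = {} \<Longrightarrow>
          Q \<subseteq> (G1 \<union> inside G1) - G2 \<or> Q \<subseteq> (G2 \<union> inside G2) - G1"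
proof -
  have ab: "a \<noteq> b" using arc_distinct_ends[OF c1(1)] c1 by auto
  have inG: "inside G \<inter> G = {}" by simp
  have ab_in: "a \<in> path_image c" "b \<in> path_image c" "a \<in> path_image c1" "b \<in> path_image c1"
      "a \<in> path_image c2" "b \<in> path_image c2"
    using c c1 c2 by (metis pathstart_in_path_image pathfinish_in_path_image)+
  have c1c: "path_image c1 \<inter> path_image c = {a, b}" and c2c: "path_image c2 \<inter> path_image c = {a, b}"
    using crosscut inG ab_in unfolding G_def by blast+
  \<comment> \<open>The midpoint of the arc differs from both ends and therefore witnesses that the
    arc really enters the inside, as the splitting theorem demands.\<close>
  have "c (1/2) \<in> path_image c" by (simp add: path_image_def)
  moreover have "c (1/2) \<notin> {a, b}"
    using c inj_onD[of c "{0..1}" "1/2" 0] inj_onD[of c "{0..1}" "1/2" 1]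
    by (auto simp: arc_def pathstart_def pathfinish_def)
  ultimately have ne: "path_image c \<inter> inside (path_image c1 \<union> path_image c2) \<noteq> {}"
    using crosscut by blast
  have disj: "inside G1 \<inter> inside G2 = {}"
    and un: "inside G1 \<union> inside G2 \<union> (path_image c - {a, b}) = inside G"
    using split_inside_simple_closed_curve[OF arc_imp_simple_path[OF c1(1)] c1(2,3)
        arc_imp_simple_path[OF c2(1)] c2(2,3) arc_imp_simple_path[OF c(1)] c(2,3) ab c12 c1c c2c ne]
    unfolding G1_def G2_def G_def by metis+
  show cc: "closed_curve G1" "closed_curve G2"
    unfolding G1_def G2_def using closed_curve_join c1 c2 c c1c c2c by blast+
  show "inside G1 \<subseteq> inside G" "inside G2 \<subseteq> inside G" using un by auto
  have no: "inside G1 \<inter> G1 = {}" "inside G2 \<inter> G2 = {}" by simp_all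
  have no12: "inside G1 \<inter> G2 = {}" "inside G2 \<inter> G1 = {}"
    using no un inG unfolding G1_def G2_def G_def by blast+
  show Z: "(G1 \<union> inside G1) \<inter> (G2 \<union> inside G2) = path_image c"
    using disj no no12 c12 c1c c2c ab_in unfolding G1_def G2_def by blast
  fix Q assume Q: "connected Q" "Q \<subseteq> G \<union> inside G" "Q \<inter> path_image c = {}"
  \<comment> \<open>Two closed sets cover \<open>Q\<close> and have no common point in it, so
    connectedness leaves only one of them.\<close>
  have "Q \<subseteq> (G1 \<union> inside G1) \<union> (G2 \<union> inside G2)"
    using Q un unfolding G_def G1_def G2_def by blast
  moreover have "(G1 \<union> inside G1) \<inter> (G2 \<union> inside G2) \<inter> Q = {}" using Z Q(3) by blast
  ultimately have "(G1 \<union> inside G1) \<inter> Q = {} \<or> (G2 \<union> inside G2) \<inter> Q = {}"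
    using connected_closedD[OF Q(1)] closed_curve_Jordan(9)[OF cc(1)] closed_curve_Jordan(9)[OF cc(2)]
    by blast
  then show "Q \<subseteq> (G1 \<union> inside G1) - G2 \<or> Q \<subseteq> (G2 \<union> inside G2) - G1"
    using \<open>Q \<subseteq> (G1 \<union> inside G1) \<union> (G2 \<union> inside G2)\<close> by blast
qed

text \<open>If \<open>P\<close> and \<open>Q\<close> were disjoint, some piece of \<open>P\<close>
  would be a crosscut that separates \<open>g 0\<close> from \<open>g m\<close>, and the connected
  set \<open>Q\<close> could not contain both. Since \<open>P\<close> may return to the curve many
  times, the work lies in selecting that piece.\<close>

lemma chord_inside_base:
  fixes g :: "real \<Rightarrow> complex"
  assumes g: "simple_path g" "pathfinish g = pathstart g"
    and ord: "0 < u0" "u0 < m" "m < v0" "v0 < 1"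
    and P: "path P" "pathstart P = g u0" "pathfinish P = g v0"
      "path_image P \<subseteq> path_image g \<union> inside (path_image g)"
    and Q: "connected Q" "Q \<subseteq> path_image g \<union> inside (path_image g)" "g 0 \<in> Q" "g m \<in> Q"
  shows "path_image P \<inter> Q \<noteq> {}"
proof
  assume disj: "path_image P \<inter> Q = {}"
  have g01: "g 1 = g 0" using g by (simp add: pathstart_def pathfinish_def)
  have gcont: "continuous_on {0..1} g" using g(1) by (simp add: simple_path_def path_def)
  have Pcont: "continuous_on {0..1} P" using P(1) by (simp add: path_def)
  have notQ: "P t \<notin> Q" if "t \<in> {0..1}" for t
    using disj that unfolding path_image_def by blast
  have cl1: "closed (g ` {0..m})" and cl2: "closed (g ` {m..1})"
    using ord by (auto intro!: compact_imp_closed compact_continuous_image continuous_on_subset[OF gcont])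
  have img: "path_image g = g ` {0..m} \<union> g ` {m..1}"
    using ord by (simp add: path_image_def image_Un[symmetric] ivl_disj_un)
  have meet: "x = g 0 \<or> x = g m" if x: "x \<in> g ` {0..m}" "x \<in> g ` {m..1}" for x
  proof -
    obtain s t where st: "x = g s" "x = g t" "0 \<le> s" "s \<le> m" "m \<le> t" "t \<le> 1"
      using x by (elim imageE) auto
    show ?thesis
    proof (cases "t = 1")
      case False
      then have "s = t" using simple_path_eqD[OF g(1), of s t] st ord by auto
      then show ?thesis using st by auto
    qed (use st g01 in auto)
  qed
  \<comment> \<open>\<open>t2\<close> is the first time at which \<open>P\<close> is on the boundary
    arc over \<open>{m..1}\<close>.\<close>
  define T2 where "T2 = {t \<in> {0..1}. P t \<in> g ` {m..1}}"
  define t2 where "t2 = Inf T2"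
  have "closed T2" unfolding T2_def
    using continuous_closed_preimage[OF Pcont _ cl2] by (simp add: vimage_def Int_def)
  moreover have "1 \<in> T2" using P(3) ord by (auto simp: T2_def pathfinish_def)
  moreover have bdd: "bdd_below T2" by (rule bdd_belowI[of _ 0]) (simp add: T2_def)
  ultimately have t2: "t2 \<in> T2" unfolding t2_def by (intro closed_contains_Inf) auto
  \<comment> \<open>\<open>t1\<close> is the last time up to \<open>t2\<close> at which
    \<open>P\<close> is on the other boundary arc. Strictly between \<open>t1\<close> and
    \<open>t2\<close> the path is off the curve, hence inside.\<close>
  define T1 where "T1 = {t \<in> {0..t2}. P t \<in> g ` {0..m}}"
  define t1 where "t1 = Sup T1"
  have t2le: "0 \<le> t2" "t2 \<le> 1" using t2 by (auto simp: T2_def)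
  have "continuous_on {0..t2} P" by (rule continuous_on_subset[OF Pcont]) (use t2le in auto)
  then have "closed T1" unfolding T1_def
    using continuous_closed_preimage[OF _ _ cl1] by (fastforce simp: vimage_def Int_def)
  moreover have "0 \<in> T1" using P(2) ord t2le by (auto simp: T1_def pathstart_def)
  moreover have bdd1: "bdd_above T1" by (rule bdd_aboveI[of _ t2]) (simp add: T1_def)
  ultimately have t1: "t1 \<in> T1" unfolding t1_def by (intro closed_contains_Sup) auto
  have t1le: "0 \<le> t1" "t1 \<le> t2" using t1 by (auto simp: T1_def)
  obtain u where u: "0 \<le> u" "u \<le> m" "P t1 = g u" using t1 by (auto simp: T1_def)
  obtain v where v: "m \<le> v" "v \<le> 1" "P t2 = g v" using t2 by (auto simp: T2_def)
  have "P t1 \<notin> Q" "P t2 \<notin> Q" using notQ t1le t2le by auto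
  \<comment> \<open>The ends of the piece avoid \<open>g 0\<close> and \<open>g m\<close>, because
    these belong to \<open>Q\<close>; so they still separate \<open>g 0\<close> from
    \<open>g m\<close> on the curve.\<close>
  then have u': "0 < u" "u < m" and v': "m < v" "v < 1"
    using u v Q(3,4) g01 by (auto simp: order_le_less)
  have ab: "P t1 \<noteq> P t2"
    using simple_path_eqD[OF g(1), of u v] u v u' v' by auto
  have "t1 < t2" using ab t1le by (auto simp: order_le_less)
  have between: "P t \<in> inside (path_image g)" if t: "t1 < t" "t < t2" for t
  proof -
    have "t \<notin> T2" using cInf_lower[OF _ bdd, of t] t unfolding t2_def by auto
    moreover have "t \<notin> T1" using cSup_upper[OF _ bdd1, of t] t unfolding t1_def by auto
    ultimately have "P t \<notin> path_image g"
      using t t1le t2le unfolding img T1_def T2_def by auto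
    moreover have "P t \<in> path_image P" using t t1le t2le by (auto simp: path_image_def)
    ultimately show ?thesis using P(4) by blast
  qed
  \<comment> \<open>The selected piece may cross itself; an arc within it keeps the ends and is a
    crosscut.\<close>
  obtain c where c: "arc c" "path_image c \<subseteq> path_image (subpath t1 t2 P)"
      "pathstart c = g u" "pathfinish c = g v"
    using path_contains_arc[of "subpath t1 t2 P" "g u" "g v"] P(1) t1le t2le ab u v by auto
  have cP: "path_image c \<subseteq> P ` {t1..t2}" using c(2) t1le by (simp add: path_image_subpath)
  have crosscut: "path_image c - {g u, g v} \<subseteq> inside (path_image g)"
  proof
    fix x assume x: "x \<in> path_image c - {g u, g v}"
    then obtain t where t: "x = P t" "t1 \<le> t" "t \<le> t2" using cP by auto
    then have "t \<noteq> t1" "t \<noteq> t2" using x u v by auto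
    then show "x \<in> inside (path_image g)" using between t by auto
  qed
  \<comment> \<open>\<open>c1\<close> is the boundary arc through \<open>g m\<close>.
    \<open>c2\<close> is the complementary arc through \<open>g 0 = g 1\<close>: back from
    \<open>u\<close> to 0, then from 1 back to \<open>v\<close>.\<close>
  define c1 where "c1 = subpath u v g"
  define c2 where "c2 = subpath u 0 g +++ subpath 1 v g"
  have im1: "path_image c1 = g ` {u..v}" unfolding c1_def using u' v' by (simp add: path_image_subpath)
  have im2: "path_image c2 = g ` {0..u} \<union> g ` {v..1}" unfolding c2_def
    using u' v' g01 by (subst path_image_join) (auto simp: path_image_subpath)
  have guv: "g u \<noteq> g v" using ab u v by simp
  have arc1: "arc c1" unfolding c1_def
    using u' v' guv ord by (intro arc_simple_path_subpath g) auto
  have arc2: "arc c2" unfolding c2_def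
  proof (rule arc_join)
    have "g u \<noteq> g 0" "g 1 \<noteq> g v" 
      using simple_path_eqD[OF g(1), of u 0] simple_path_eqD[OF g(1), of v 0] u' v' g01 ord by force+
    then show "arc (subpath u 0 g)" "arc (subpath 1 v g)"
      using u' v' ord by (auto intro!: arc_simple_path_subpath g)
    show "path_image (subpath u 0 g) \<inter> path_image (subpath 1 v g) \<subseteq> {pathstart (subpath 1 v g)}"
    proof
      fix x assume "x \<in> path_image (subpath u 0 g) \<inter> path_image (subpath 1 v g)"
      then have "x \<in> g ` {0..u}" "x \<in> g ` {v..1}"
        using u' v' by (auto simp: path_image_subpath)
      then obtain s t where st: "x = g s" "x = g t" "0 \<le> s" "s \<le> u" "v \<le> t" "t \<le> 1"
        by (elim imageE) auto
      then have "t = 1" using simple_path_eqD[OF g(1), of s t] u' v' by force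
      then show "x \<in> {pathstart (subpath 1 v g)}" using st by simp
    qed
  qed (use g01 in simp)
  have c12: "path_image c1 \<inter> path_image c2 = {g u, g v}"
  proof
    show "path_image c1 \<inter> path_image c2 \<subseteq> {g u, g v}"
    proof
      fix x assume "x \<in> path_image c1 \<inter> path_image c2"
      then have x: "x \<in> g ` {u..v}" "x \<in> g ` ({0..u} \<union> {v..1})" unfolding im1 im2 by blast+
      obtain s where s: "x = g s" "u \<le> s" "s \<le> v" using x(1) by auto
      obtain t where "x = g t" "t \<in> {0..u} \<union> {v..1}" using x(2) by blast
      with s have st: "x = g s" "x = g t" "u \<le> s" "s \<le> v" "0 \<le> t" "t \<le> u \<or> v \<le> t" "t \<le> 1"
        using u' v' by auto
      then have "s = t" using simple_path_interior_eqD[OF g(1), of s t] u' v' by auto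
      then show "x \<in> {g u, g v}" using st by auto
    qed
    show "{g u, g v} \<subseteq> path_image c1 \<inter> path_image c2"
      unfolding im1 im2 using u' v' by auto
  qed
  have c1_un_c2: "path_image c1 \<union> path_image c2 = path_image g"
  proof -
    have "{u..v} \<union> ({0..u} \<union> {v..1}) = {0..1}" using u' v' by auto
    then show ?thesis unfolding im1 im2 path_image_def[of g] by (simp only: image_Un[symmetric])
  qed
  have ends: "pathstart c1 = g u" "pathfinish c1 = g v" "pathstart c2 = g u" "pathfinish c2 = g v"
    by (simp_all add: c1_def c2_def)
  note \<theta> = theta_split[OF arc1 ends(1,2) arc2 ends(3,4) c(1,3,4) c12, unfolded c1_un_c2, OF crosscut]
  have "Q \<inter> path_image c = {}"
  proof -
    have "P ` {t1..t2} \<subseteq> path_image P" using t1le t2le by (auto simp: path_image_def)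
    then show ?thesis using disj cP by blast
  qed
  from \<theta>(6)[OF Q(1,2) this]
  have "Q \<inter> path_image c2 = {} \<or> Q \<inter> path_image c1 = {}" by blast
  moreover have "g 0 \<in> path_image c2" "g m \<in> path_image c1"
    unfolding im1 im2 using u' v' by auto
  ultimately show False using Q(3,4) by blast
qed

section \<open>Inversions and chords on either side of a Jordan curve\<close>

definition closed_sides :: "complex set \<Rightarrow> complex set set" where
  "closed_sides A = {A \<union> inside A, A \<union> outside A}"

lemma continuous_on_inversion:
  "a \<notin> S \<Longrightarrow> continuous_on S (\<lambda>z::complex. inverse (z - a))"
  by (intro continuous_intros) auto

text \<open>Injectivity on the whole plane relies on the convention \<open>inverse 0 = 0\<close>:
  the centre \<open>a\<close> is the only point sent to 0.\<close>

lemma inj_inversion: "inj (\<lambda>z::complex. inverse (z - a))"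
  by (rule injI) (metis add_diff_cancel_right' diff_add_cancel inverse_inverse_eq)

lemma simple_path_inversion:
  assumes "simple_path g" "pathfinish g = pathstart g" "a \<notin> path_image g"
  defines "f \<equiv> \<lambda>z::complex. inverse (z - a)"
  shows "simple_path (f \<circ> g)" "pathfinish (f \<circ> g) = pathstart (f \<circ> g)"
    "path_image (f \<circ> g) = f ` path_image g"
  using assms simple_path_continuous_image[OF assms(1) continuous_on_inversion[OF assms(3)]]
  by (auto simp: inj_on_subset[OF inj_inversion] path_image_compose pathfinish_compose pathstart_compose)

lemma closed_curve_inversion:
  assumes "closed_curve A" "a \<notin> A"
  shows "closed_curve ((\<lambda>z. inverse (z - a)) ` A)"
  using assms simple_path_inversion unfolding closed_curve_def by metis

text \<open>Suppose an outside point were sent outside the image curve. Pulling the outside of the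
  image curve back gives a connected set that misses \<open>A\<close>, contains that point, and also
  contains points close to the centre \<open>a\<close>. It would join the outside of
  \<open>A\<close> to its inside.\<close>

lemma inversion_outside:
  assumes A: "closed_curve A" and a: "a \<in> inside A"
  defines "f \<equiv> \<lambda>z::complex. inverse (z - a)"
  shows "f ` outside A \<subseteq> inside (f ` A)"
proof (rule image_subsetI, rule ccontr)
  fix z assume z: "z \<in> outside A" and "f z \<notin> inside (f ` A)"
  have aA: "a \<notin> A" "a \<notin> outside A"
    using a inside_no_overlap[of A] inside_Int_outside[of A] by blast+
  have zA: "z \<notin> A" "z \<noteq> a" using z outside_no_overlap[of A] aA by blast+
  have cfA: "closed_curve (f ` A)" unfolding f_def using closed_curve_inversion A aA by blast
  have "f z \<notin> f ` A" using zA inj_image_mem_iff[OF inj_inversion] unfolding f_def by blast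
  then have fz: "f z \<in> outside (f ` A)"
    using \<open>f z \<notin> inside (f ` A)\<close> inside_Un_outside[of "f ` A"] by blast
  \<comment> \<open>The point 0 corresponds to infinity under the inverse map and must be removed; a
    connected open set in the plane stays connected without it.\<close>
  define O' where "O' = outside (f ` A) - {0}"
  define h where "h = (\<lambda>w::complex. a + inverse w)"
  have "connected O'" unfolding O'_def
    using connected_open_delete[OF closed_curve_Jordan(4,6)[OF cfA]] by simp
  moreover have "continuous_on O' h" unfolding h_def O'_def by (intro continuous_intros) auto
  ultimately have conn: "connected (h ` O')" using connected_continuous_image by blast
  have "f z \<noteq> 0" using zA by (simp add: f_def)
  then have "z \<in> h ` O'"
    using fz by (intro image_eqI[of _ _ "f z"]) (auto simp: O'_def h_def f_def)
  moreover have "h ` O' \<inter> A = {}"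
  proof -
    have "w \<notin> outside (f ` A)" if "h w \<in> A" "w \<noteq> 0" for w
    proof -
      have "w = f (h w)" by (simp add: f_def h_def)
      then have "w \<in> f ` A" using that by blast
      then show ?thesis using outside_no_overlap[of "f ` A"] by blast
    qed
    then show ?thesis by (auto simp: O'_def)
  qed
  moreover have "h ` O' \<inter> inside A \<noteq> {}"
  proof -
    obtain e where e: "e > 0" "ball a e \<subseteq> inside A"
      using closed_curve_Jordan(3)[OF A] a by (meson open_contains_ball)
    obtain R where R: "\<And>x. x \<in> f ` A \<Longrightarrow> norm x \<le> R"
      using closed_curve_Jordan(1)[OF cfA] compact_imp_bounded bounded_iff by metis
    \<comment> \<open>A point so far out that it lies outside the bounded image curve and that its
      preimage is within \<open>e\<close> of \<open>a\<close>.\<close>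
    define w where "w = of_real (max \<bar>R\<bar> (1/e) + 1) * (1::complex)"
    have nw: "norm w = max \<bar>R\<bar> (1/e) + 1" by (simp add: w_def)
    have "w \<in> outside (f ` A)"
    proof -
      have "- cball 0 \<bar>R\<bar> \<subseteq> outside (f ` A)"
      proof (rule outside_subset_convex)
        show "f ` A \<subseteq> cball 0 \<bar>R\<bar>"
        proof
          fix x assume "x \<in> f ` A"
          then have "norm x \<le> R" by (rule R)
          then show "x \<in> cball 0 \<bar>R\<bar>" by simp
        qed
      qed simp
      moreover have "norm w > \<bar>R\<bar>" using nw by linarith
      ultimately show ?thesis by auto
    qed
    moreover have "w \<noteq> 0" using nw by force
    moreover have "h w \<in> ball a e"
    proof -
      have "norm w > 1/e" using nw by linarith
      then have "inverse (norm w) < inverse (1/e)"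
        by (rule less_imp_inverse_less) (use e in simp)
      then show ?thesis by (simp add: h_def dist_norm norm_inverse)
    qed
    ultimately show ?thesis using e(2) unfolding O'_def by blast
  qed
  ultimately show False
    using inside_outside_intersect_connected[OF conn, of A] z by blast
qed

text \<open>An inversion centred at a point inside the curve carries the outer side into the inner
  side of the image curve, which reduces the outer case to \<open>chord_inside_base\<close>.\<close>

lemma chord_base:
  fixes g :: "real \<Rightarrow> complex"
  assumes g: "simple_path g" "pathfinish g = pathstart g"
    and K: "K \<in> closed_sides (path_image g)"
    and ord: "0 < u0" "u0 < m" "m < v0" "v0 < 1"
    and P: "path P" "pathstart P = g u0" "pathfinish P = g v0" "path_image P \<subseteq> K"
    and Q: "connected Q" "Q \<subseteq> K" "g 0 \<in> Q" "g m \<in> Q"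
  shows "path_image P \<inter> Q \<noteq> {}"
proof (cases "K = path_image g \<union> inside (path_image g)")
  case True
  then show ?thesis using chord_inside_base[OF g ord P(1-3)] P(4) Q by blast
next
  case False
  then have K: "K = path_image g \<union> outside (path_image g)"
    using K by (auto simp: closed_sides_def)
  have cc: "closed_curve (path_image g)" using g by (rule closed_curveI)
  obtain a where a: "a \<in> inside (path_image g)" using closed_curve_Jordan(7)[OF cc] by blast
  then have "a \<notin> path_image g" "a \<notin> K"
    unfolding K using inside_no_overlap[of "path_image g"] inside_Int_outside[of "path_image g"] by blast+
  define f where "f = (\<lambda>z::complex. inverse (z - a))"
  note fg = simple_path_inversion[OF g \<open>a \<notin> path_image g\<close>, folded f_def]
  have contK: "continuous_on K f" unfolding f_def by (rule continuous_on_inversion[OF \<open>a \<notin> K\<close>])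
  have fK: "f ` K \<subseteq> path_image (f \<circ> g) \<union> inside (path_image (f \<circ> g))"
  proof -
    have "f ` outside (path_image g) \<subseteq> inside (f ` path_image g)"
      unfolding f_def by (rule inversion_outside[OF cc a])
    then show ?thesis unfolding K fg(3) image_Un by auto
  qed
  have "path_image (f \<circ> P) \<inter> f ` Q \<noteq> {}"
  proof (rule chord_inside_base[OF fg(1,2) ord])
    show "path (f \<circ> P)"
      using P(1) by (rule path_continuous_image) (rule continuous_on_subset[OF contK P(4)])
    show "connected (f ` Q)"
      by (rule connected_continuous_image[OF continuous_on_subset[OF contK Q(2)] Q(1)])
    show "path_image (f \<circ> P) \<subseteq> path_image (f \<circ> g) \<union> inside (path_image (f \<circ> g))"
      using P(4) fK unfolding path_image_compose by blast
  qed (use P Q fK in \<open>auto simp: pathstart_def pathfinish_def\<close>)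
  moreover have "path_image (f \<circ> P) \<inter> f ` Q = f ` (path_image P \<inter> Q)"
    unfolding path_image_compose f_def by (rule image_Int[OF inj_inversion, symmetric])
  ultimately show ?thesis by auto
qed

text \<open>Rotating the parametrization so that it starts at \<open>g s2\<close> brings four
  interlacing points into the position required by \<open>chord_base\<close>. The ends of
  \<open>P\<close> then appear in the opposite order, so \<open>P\<close> is reversed.\<close>

lemma chords_intersect:
  fixes g :: "real \<Rightarrow> complex"
  assumes g: "simple_path g" "pathfinish g = pathstart g"
    and K: "K \<in> closed_sides (path_image g)"
    and ord: "0 \<le> s1" "s1 < s2" "s2 < s3" "s3 < s4" "s4 < 1"
    and P: "path P" "pathstart P = g s1" "pathfinish P = g s3" "path_image P \<subseteq> K"
    and Q: "connected Q" "Q \<subseteq> K" "g s2 \<in> Q" "g s4 \<in> Q"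
  shows "path_image P \<inter> Q \<noteq> {}"
proof -
  define h where "h = shiftpath s2 g"
  have h: "simple_path h" "pathfinish h = pathstart h" "path_image h = path_image g"
    unfolding h_def using g ord
    by (auto simp: simple_path_shiftpath closed_shiftpath path_image_shiftpath)
  \<comment> \<open>\<open>s1\<close> precedes the new starting point, so its parameter wraps around
    and gains 1.\<close>
  have val: "h 0 = g s2" "h (s3 - s2) = g s3" "h (s4 - s2) = g s4" "h (1 + s1 - s2) = g s1"
    unfolding h_def shiftpath_def using ord g by (auto simp: pathstart_def pathfinish_def)
  have "path_image (reversepath P) \<inter> Q \<noteq> {}"
    by (rule chord_base[OF h(1,2), of K "s3 - s2" "s4 - s2" "1 + s1 - s2"])
      (use K P Q ord h(3) val in auto)
  then show ?thesis by simp
qed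

section \<open>A Jordan curve separating the two families\<close>

text \<open>Each curve of \<open>S\<close> meets the cut at most once, so it stays connected off the
  cut and lies in one of the two closed discs. Curves in different discs could meet only on the cut,
  which is excluded; hence one disc contains all of them, and its boundary is the new curve.\<close>

lemma cut_along_crosscut:
  assumes G: "closed_curve G"
    and c: "arc c" "pathstart c = a" "pathfinish c = b" "a \<in> G" "b \<in> G"
      "path_image c - {a, b} \<subseteq> inside G"
    and S: "\<And>B. B \<in> S \<Longrightarrow> closed_curve B" "\<And>B. B \<in> S \<Longrightarrow> B \<subseteq> G \<union> inside G"
      "\<And>B. B \<in> S \<Longrightarrow> \<exists>p. B \<inter> path_image c \<subseteq> {p}"
      "\<And>B C. B \<in> S \<Longrightarrow> C \<in> S \<Longrightarrow> B \<noteq> C \<Longrightarrow> B \<inter> C \<noteq> {} \<and> B \<inter> C \<inter> path_image c = {}"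
  obtains G' where "closed_curve G'" "G' \<subseteq> G \<union> path_image c" "path_image c \<subseteq> G'"
    "inside G' \<subseteq> inside G" "\<And>B. B \<in> S \<Longrightarrow> B \<subseteq> G' \<union> inside G'"
proof -
  have ab: "a \<noteq> b" using arc_distinct_ends[OF c(1)] c by auto
  obtain c1 c2 where c1: "arc c1" "pathstart c1 = a" "pathfinish c1 = b"
    and c2: "arc c2" "pathstart c2 = a" "pathfinish c2 = b"
    and un: "path_image c1 \<union> path_image c2 = G" and int: "path_image c1 \<inter> path_image c2 = {a, b}"
    using closed_curve_splitE[OF G c(4,5) ab] by metis
  define G1 G2 where "G1 = path_image c1 \<union> path_image c" and "G2 = path_image c2 \<union> path_image c"
  note \<theta> = theta_split[OF c1 c2 c(1-3) int, unfolded un, OF c(6), folded G1_def G2_def]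
  have side: "B \<subseteq> G1 \<union> inside G1 \<or> B \<subseteq> G2 \<union> inside G2" if B: "B \<in> S" for B
  proof -
    obtain p where p: "B \<inter> path_image c \<subseteq> {p}" using S(3)[OF B] by blast
    have "B - path_image c = B - {p} \<or> B - path_image c = B" using p by blast
    then have "connected (B - path_image c)"
      using closed_curve_delete_connected[OF S(1)[OF B]] closed_curve_Jordan(2)[OF S(1)[OF B]] by metis
    moreover have "B - path_image c \<subseteq> G \<union> inside G" using S(2)[OF B] by blast
    ultimately have "B - path_image c \<subseteq> G1 \<union> inside G1 \<or> B - path_image c \<subseteq> G2 \<union> inside G2"
      using \<theta>(6)[of "B - path_image c"] by blast
    then show ?thesis unfolding G1_def G2_def by blast
  qed
  have "(\<forall>B\<in>S. B \<subseteq> G1 \<union> inside G1) \<or> (\<forall>B\<in>S. B \<subseteq> G2 \<union> inside G2)"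
  proof (rule ccontr)
    assume "\<not> ?thesis"
    then obtain B C where BC: "B \<in> S" "\<not> B \<subseteq> G1 \<union> inside G1" "C \<in> S" "\<not> C \<subseteq> G2 \<union> inside G2"
      by blast
    then have "B \<subseteq> G2 \<union> inside G2" "C \<subseteq> G1 \<union> inside G1" using side by blast+
    then have "B \<inter> C \<subseteq> path_image c" "B \<noteq> C" using \<theta>(5) BC by blast+
    then show False using S(4)[OF BC(1,3)] by blast
  qed
  then show ?thesis
  proof
    assume "\<forall>B\<in>S. B \<subseteq> G1 \<union> inside G1"
    then show ?thesis using that[of G1] \<theta>(1,3) un unfolding G1_def by blast
  next
    assume "\<forall>B\<in>S. B \<subseteq> G2 \<union> inside G2"
    then show ?thesis using that[of G2] \<theta>(2,4) un unfolding G2_def by blast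
  qed
qed

text \<open>\<open>G0\<close> divides \<open>X\<close> into finitely many arcs. Those running inside
  are crosscuts, and the disc is cut along them one at a time. The points \<open>x1\<close> and
  \<open>x2\<close> exclude the degenerate case in which all of \<open>X\<close> except one point
  lies inside, where the arc would be a closed loop and no crosscut.\<close>

lemma push_off_curve:
  assumes G0: "closed_curve G0" and X: "closed_curve X" and fin: "finite (X \<inter> G0)"
    and x12: "x1 \<in> X" "x2 \<in> X" "x1 \<noteq> x2" "x1 \<notin> inside G0" "x2 \<notin> inside G0"
    and S: "\<And>B. B \<in> S \<Longrightarrow> closed_curve B" "\<And>B. B \<in> S \<Longrightarrow> B \<subseteq> G0 \<union> inside G0"
      "\<And>B. B \<in> S \<Longrightarrow> \<exists>p. B \<inter> X \<subseteq> {p}"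
      "\<And>B C. B \<in> S \<Longrightarrow> C \<in> S \<Longrightarrow> B \<noteq> C \<Longrightarrow> B \<inter> C \<noteq> {} \<and> B \<inter> C \<inter> X = {}"
  obtains G where "closed_curve G" "G \<subseteq> G0 \<union> X" "inside G \<subseteq> inside G0" "X \<inter> inside G = {}"
    "\<And>B. B \<in> S \<Longrightarrow> B \<subseteq> G \<union> inside G"
proof (cases "X \<inter> inside G0 = {}")
  case True
  then show ?thesis using that[of G0] G0 S by blast
next
  case False
  have "X \<inter> G0 \<noteq> {}"
  proof
    assume "X \<inter> G0 = {}"
    moreover have "x1 \<in> outside G0"
      using x12 calculation inside_Un_outside[of G0] by blast
    ultimately show False
      using inside_outside_intersect_connected[OF closed_curve_Jordan(2)[OF X], of G0] False x12 by blast
  qed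
  then obtain z where z: "z \<in> X" "z \<in> G0" by blast
  obtain h where h: "simple_path h" "pathfinish h = pathstart h" "path_image h = X" "h 0 = z" "h 1 = z"
    using closed_curve_startE[OF X z(1)] .
  have hcont: "continuous_on {0..1} h" using h(1) by (simp add: simple_path_def path_def)
  have hX: "h t \<in> X" if "0 \<le> t" "t \<le> 1" for t
    using h(3) that by (auto simp: path_image_def)
  define T where "T = {t \<in> {0..1}. h t \<in> G0}"
  have "finite (T - {1})"
  proof (rule finite_imageD)
    show "finite (h ` (T - {1}))"
      by (rule finite_subset[OF _ fin]) (auto simp: T_def intro: hX)
    show "inj_on h (T - {1})"
      by (rule inj_onI) (auto simp: T_def intro: simple_path_eqD[OF h(1)])
  qed
  then have finT: "finite T" by simp
  have T01: "0 \<in> T" "1 \<in> T" using z h by (auto simp: T_def)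
  \<comment> \<open>A gap is a pair of consecutive parameters at which \<open>X\<close> is on
    \<open>G0\<close>. Since the parametrization starts on \<open>G0\<close>, both 0 and 1 belong to
    \<open>T\<close>.\<close>
  define gaps where "gaps = {(s, t). s \<in> T \<and> t \<in> T \<and> s < t \<and> T \<inter> {s<..<t} = {}}"
  have gapD: "s \<in> T" "t \<in> T" "s < t" "T \<inter> {s<..<t} = {}" "0 \<le> s" "t \<le> 1" if "(s, t) \<in> gaps" for s t
    using that by (auto simp: gaps_def T_def)
  have gap_unique: "s = s' \<and> t = t'"
    if "(s, t) \<in> gaps" "(s', t') \<in> gaps" "s < x" "x < t" "s' < x" "x < t'" for s t s' t' x
  proof -
    have "s' \<notin> {s<..<t}" "s \<notin> {s'<..<t'}" "t' \<notin> {s<..<t}" "t \<notin> {s'<..<t'}"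
      using gapD[OF that(1)] gapD[OF that(2)] by blast+
    then show ?thesis using that(3-6) by auto
  qed
  have "finite gaps" by (rule finite_subset[of _ "T \<times> T"]) (use finT in \<open>auto simp: gaps_def\<close>)
  \<comment> \<open>Induction over the gaps already treated. The curve consists only of points of
    \<open>G0\<close> and of treated arcs, and its inside shrinks, so treated gaps remain off
    it.\<close>
  have "\<exists>G. closed_curve G \<and> G \<subseteq> G0 \<union> (\<Union>p\<in>F. h ` {fst p..snd p}) \<and> inside G \<subseteq> inside G0 \<and>
      (\<forall>s t. (s, t) \<in> F \<longrightarrow> h ` {s<..<t} \<inter> inside G = {}) \<and> (\<forall>B\<in>S. B \<subseteq> G \<union> inside G)"
    if "finite F" "F \<subseteq> gaps" for F
    using that
  proof (induction F rule: finite_induct)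
    case empty
    show ?case by (intro exI[of _ G0]) (use G0 S(2) in simp)
  next
    case (insert st F)
    obtain s t where st: "st = (s, t)" by fastforce
    have "F \<subseteq> gaps" using insert.prems by simp
    from insert.IH[OF this] obtain G where "closed_curve G \<and> G \<subseteq> G0 \<union> (\<Union>p\<in>F. h ` {fst p..snd p}) \<and>
      inside G \<subseteq> inside G0 \<and> (\<forall>s t. (s, t) \<in> F \<longrightarrow> h ` {s<..<t} \<inter> inside G = {}) \<and>
      (\<forall>B\<in>S. B \<subseteq> G \<union> inside G)" ..
    then have G: "closed_curve G" "G \<subseteq> G0 \<union> (\<Union>p\<in>F. h ` {fst p..snd p})" "inside G \<subseteq> inside G0"
      "\<And>s t. (s, t) \<in> F \<Longrightarrow> h ` {s<..<t} \<inter> inside G = {}" "\<And>B. B \<in> S \<Longrightarrow> B \<subseteq> G \<union> inside G"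
      by blast+
    have stg: "(s, t) \<in> gaps" using insert st by auto
    note g = gapD[OF stg]
    define U where "U = h ` {s<..<t}"
    show ?case
    proof (cases "U \<inter> inside G = {}")
      case True
      have "G \<subseteq> G0 \<union> (\<Union>p\<in>insert st F. h ` {fst p..snd p})" using G(2) by blast
      moreover have "\<forall>s t. (s, t) \<in> insert st F \<longrightarrow> h ` {s<..<t} \<inter> inside G = {}"
        using True G(4) unfolding U_def st by blast
      ultimately show ?thesis using G(1,3,5) by blast
    next
      case False
      \<comment> \<open>An untreated open gap misses \<open>G0\<close> by definition, and it misses
        the treated arcs because \<open>h\<close> is simple and distinct gaps do not
        overlap.\<close>
      have "U \<inter> G = {}"
      proof (rule ccontr)
        assume "U \<inter> G \<noteq> {}"
        then obtain x where x: "s < x" "x < t" "h x \<in> G" unfolding U_def by auto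
        have "x \<notin> T" using x g(4) by auto
        then have "h x \<notin> G0" using x g(5,6) by (auto simp: T_def)
        then obtain s' t' where F: "(s', t') \<in> F" "h x \<in> h ` {s'..t'}" using G(2) x(3) by auto
        then obtain y where y: "s' \<le> y" "y \<le> t'" "h x = h y" by auto
        have g': "(s', t') \<in> gaps" using F(1) insert by auto
        have "x = y"
          using simple_path_interior_eqD[OF h(1) y(3)] x g(5,6) y(1,2) gapD(5,6)[OF g'] by auto
        then have "s' < x" "x < t'"
          using y(1,2) \<open>x \<notin> T\<close> gapD(1,2)[OF g'] by (auto simp: order_le_less)
        then have "(s', t') = (s, t)" using gap_unique[OF stg g' x(1,2)] by auto
        then show False using F(1) insert st by auto
      qed
      have "connected U" unfolding U_def
        by (rule connected_continuous_image) (use g in \<open>auto intro: continuous_on_subset[OF hcont]\<close>)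
      then have Uin: "U \<subseteq> inside G"
        using inside_outside_intersect_connected[of U G] False \<open>U \<inter> G = {}\<close> inside_Un_outside[of G]
        by blast
      \<comment> \<open>By continuity the ends of the gap lie in the closed disc of
        \<open>G\<close>. Being on \<open>G0\<close> they are not inside \<open>G\<close>, so they
        lie on \<open>G\<close> itself.\<close>
      have "h ` {s..t} \<subseteq> G \<union> inside G"
      proof -
        have "closure {s<..<t} = {s..t}" using g by simp
        then show ?thesis
          using image_closure_subset[of "{s<..<t}" h "G \<union> inside G"] Uin closed_curve_Jordan(9)[OF G(1)]
            continuous_on_subset[OF hcont, of "{s..t}"] g(5,6) unfolding U_def by auto
      qed
      moreover have "h s \<notin> inside G" "h t \<notin> inside G"
        using G(3) g(1,2) inside_no_overlap[of G0] unfolding T_def by blast+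
      moreover have "h s \<in> h ` {s..t}" "h t \<in> h ` {s..t}" using g(3) by auto
      ultimately have ends: "h s \<in> G" "h t \<in> G" by blast+
      \<comment> \<open>Equal ends would force the gap to be the whole parameter interval, with all
        of \<open>X\<close> except \<open>z\<close> inside \<open>G0\<close>, against the choice of
        \<open>x1\<close> and \<open>x2\<close>.\<close>
      have neq: "h s \<noteq> h t"
      proof
        assume "h s = h t"
        then have "s = 0" "t = 1"
          using h(1) g unfolding simple_path_def loop_free_def T_def by force+
        then have "X - {z} \<subseteq> inside G0"
          using Uin G(3) simple_path_endless[OF h(1)] h(3-5)
          unfolding U_def pathstart_def pathfinish_def by auto
        then show False using x12 by blast
      qed
      define c where "c = subpath s t h"
      have c: "arc c" "pathstart c = h s" "pathfinish c = h t" "path_image c = h ` {s..t}"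
        using neq g h(1) T01 unfolding c_def
        by (auto simp: path_image_subpath T_def intro!: arc_simple_path_subpath)
      have cX: "path_image c \<subseteq> X" unfolding c(4) using hX g(5,6) by auto
      have "path_image c - {h s, h t} \<subseteq> U"
      proof
        fix x assume x: "x \<in> path_image c - {h s, h t}"
        then obtain y where y: "x = h y" "s \<le> y" "y \<le> t" unfolding c(4) by auto
        then have "y \<noteq> s" "y \<noteq> t" using x by auto
        then show "x \<in> U" unfolding U_def using y by auto
      qed
      then have cin: "path_image c - {h s, h t} \<subseteq> inside G" using Uin by blast
      obtain G' where G': "closed_curve G'" "G' \<subseteq> G \<union> path_image c" "path_image c \<subseteq> G'"
        "inside G' \<subseteq> inside G" "\<And>B. B \<in> S \<Longrightarrow> B \<subseteq> G' \<union> inside G'"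
      proof (rule cut_along_crosscut[OF G(1) c(1-3) ends cin, of S])
        show "\<exists>p. B \<inter> path_image c \<subseteq> {p}" if "B \<in> S" for B using S(3)[OF that] cX by blast
        show "B \<inter> C \<noteq> {} \<and> B \<inter> C \<inter> path_image c = {}" if "B \<in> S" "C \<in> S" "B \<noteq> C" for B C
          using S(4)[OF that] cX by blast
      qed (use S(1) G(5) in auto)
      have "G' \<subseteq> G0 \<union> (\<Union>p\<in>insert st F. h ` {fst p..snd p})" using G'(2) G(2) unfolding c(4) st by auto
      moreover have "h ` {s<..<t} \<inter> inside G' = {}"
        using G'(3) inside_no_overlap[of G'] unfolding c(4) by fastforce
      then have "\<forall>s t. (s, t) \<in> insert st F \<longrightarrow> h ` {s<..<t} \<inter> inside G' = {}"
        using G(4) G'(4) unfolding st by blast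
      ultimately show ?thesis using G'(1,4,5) G(3) by blast
    qed
  qed
  from this[OF \<open>finite gaps\<close> order_refl]
  obtain G where "closed_curve G \<and> G \<subseteq> G0 \<union> (\<Union>p\<in>gaps. h ` {fst p..snd p}) \<and>
      inside G \<subseteq> inside G0 \<and> (\<forall>s t. (s, t) \<in> gaps \<longrightarrow> h ` {s<..<t} \<inter> inside G = {}) \<and>
      (\<forall>B\<in>S. B \<subseteq> G \<union> inside G)" ..
  then have G: "closed_curve G" "G \<subseteq> G0 \<union> (\<Union>p\<in>gaps. h ` {fst p..snd p})" "inside G \<subseteq> inside G0"
    "\<And>s t. (s, t) \<in> gaps \<Longrightarrow> h ` {s<..<t} \<inter> inside G = {}" "\<And>B. B \<in> S \<Longrightarrow> B \<subseteq> G \<union> inside G"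
    by blast+
  have "h ` {fst p..snd p} \<subseteq> X" if "p \<in> gaps" for p
    using hX gapD(5,6)[of "fst p" "snd p"] that by auto
  then have "G \<subseteq> G0 \<union> X" using G(2) by blast
  moreover have "X \<inter> inside G = {}"
  proof (rule ccontr)
    assume "X \<inter> inside G \<noteq> {}"
    then obtain x where x: "0 \<le> x" "x \<le> 1" "h x \<in> inside G" using h(3) by (auto simp: path_image_def)
    then have xT: "x \<notin> T" using G(3) inside_no_overlap[of G0] unfolding T_def by blast
    then have x01: "0 < x" "x < 1" using x T01 by (auto simp: order_le_less)
    \<comment> \<open>The cut parameters next to \<open>x\<close> on either side bound the gap that
      contains \<open>x\<close>.\<close>
    define s t where "s = Max {y \<in> T. y < x}" and "t = Min {y \<in> T. x < y}"
    have "s \<in> {y \<in> T. y < x}" unfolding s_def by (rule Max_in) (use finT T01 x01 in auto)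
    moreover have "t \<in> {y \<in> T. x < y}" unfolding t_def by (rule Min_in) (use finT T01 x01 in auto)
    moreover have "T \<inter> {s<..<t} = {}"
    proof -
      have "y \<le> s" if "y \<in> T" "y < x" for y unfolding s_def using finT that by (intro Max_ge) auto
      moreover have "t \<le> y" if "y \<in> T" "x < y" for y unfolding t_def using finT that by (intro Min_le) auto
      ultimately show ?thesis using xT by (force simp: not_less)
    qed
    ultimately have "(s, t) \<in> gaps" "s < x" "x < t" by (auto simp: gaps_def)
    then show False using G(4) x(3) by (metis IntI empty_iff greaterThanLessThan_iff imageI)
  qed
  ultimately show ?thesis using that[of G] G(1,3,5) by blast
qed

text \<open>The conditions on pairs and triples speak only of intersections, so that they carry over
  under injective maps such as inversions.\<close>

definition touching_families :: "complex set set \<Rightarrow> complex set set \<Rightarrow> bool" where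
  "touching_families S1 S2 \<longleftrightarrow> finite S1 \<and> finite S2 \<and> (\<forall>A \<in> S1 \<union> S2. closed_curve A) \<and>
     general_position (S1 \<union> S2) \<and> (\<forall>A \<in> S1 \<union> S2. \<forall>B \<in> S1 \<union> S2. A \<inter> B \<noteq> {}) \<and>
     (\<forall>A \<in> S1. \<forall>B \<in> S2. \<exists>p. A \<inter> B = {p})"

lemma closed_curve_not_subset_singleton:
  assumes "closed_curve A"
  shows "\<not> A \<subseteq> {p}"
proof
  assume "A \<subseteq> {p}"
  obtain g where g: "simple_path g" "path_image g = A" using assms by (auto simp: closed_curve_def)
  have "g 0 \<in> A" "g (1/2) \<in> A" unfolding g(2)[symmetric] path_image_def by auto
  then have "g 0 = g (1/2)" using \<open>A \<subseteq> {p}\<close> by blast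
  then show False using simple_path_eqD[OF g(1), of 0 "1/2"] by auto
qed

lemma touching_familiesD:
  assumes "touching_families S1 S2"
  shows "finite S1" "finite S2" "\<And>A. A \<in> S1 \<Longrightarrow> closed_curve A" "\<And>B. B \<in> S2 \<Longrightarrow> closed_curve B"
    "\<And>A B C. A \<in> S1 \<union> S2 \<Longrightarrow> B \<in> S1 \<union> S2 \<Longrightarrow> C \<in> S1 \<union> S2 \<Longrightarrow> A \<noteq> B \<Longrightarrow> A \<noteq> C \<Longrightarrow> B \<noteq> C \<Longrightarrow> A \<inter> B \<inter> C = {}"
    "\<And>A B. A \<in> S1 \<union> S2 \<Longrightarrow> B \<in> S1 \<union> S2 \<Longrightarrow> A \<noteq> B \<Longrightarrow> finite (A \<inter> B)"
    "\<And>A B. A \<in> S1 \<union> S2 \<Longrightarrow> B \<in> S1 \<union> S2 \<Longrightarrow> A \<inter> B \<noteq> {}"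
    "\<And>A B. A \<in> S1 \<Longrightarrow> B \<in> S2 \<Longrightarrow> \<exists>p. A \<inter> B = {p}"
proof -
  have tf: "finite S1" "finite S2" "\<forall>A \<in> S1 \<union> S2. closed_curve A" "general_position (S1 \<union> S2)"
    "\<forall>A \<in> S1 \<union> S2. \<forall>B \<in> S1 \<union> S2. A \<inter> B \<noteq> {}" "\<forall>A \<in> S1. \<forall>B \<in> S2. \<exists>p. A \<inter> B = {p}"
    using assms unfolding touching_families_def by simp_all
  note gp = tf(4)[unfolded general_position_def]
  show "finite S1" "finite S2" by (fact tf)+
  show "closed_curve A" if "A \<in> S1" for A using tf(3) that by simp
  show "closed_curve B" if "B \<in> S2" for B using tf(3) that by simp
  show "A \<inter> B \<inter> C = {}"
    if "A \<in> S1 \<union> S2" "B \<in> S1 \<union> S2" "C \<in> S1 \<union> S2" "A \<noteq> B" "A \<noteq> C" "B \<noteq> C" for A B C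
    using gp[THEN conjunct1, rule_format, OF that(1-3)] that(4-6) by simp
  show "finite (A \<inter> B)" if "A \<in> S1 \<union> S2" "B \<in> S1 \<union> S2" "A \<noteq> B" for A B
    using gp[THEN conjunct2, rule_format, OF that] .
  show "A \<inter> B \<noteq> {}" if "A \<in> S1 \<union> S2" "B \<in> S1 \<union> S2" for A B
    using tf(5)[rule_format, OF that] .
  show "\<exists>p. A \<inter> B = {p}" if "A \<in> S1" "B \<in> S2" for A B
    using tf(6)[rule_format, OF that] .
qed

lemma touching_families_disjoint:
  assumes "touching_families S1 S2"
  shows "S1 \<inter> S2 = {}"
proof (rule ccontr)
  assume "S1 \<inter> S2 \<noteq> {}"
  then obtain A where A: "A \<in> S1" "A \<in> S2" by blast
  then obtain p where "A \<inter> A = {p}" using touching_familiesD(8)[OF assms] by blast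
  then show False using closed_curve_not_subset_singleton touching_familiesD(3)[OF assms A(1)] by blast
qed

text \<open>Starting with the disc bounded by \<open>X0\<close>, the other curves of
  \<open>S1\<close> are pushed off one after the other. Each push requires two points of the curve
  that are not inside the current disc: for \<open>X1\<close> two of its points on
  \<open>X0\<close>, which is why these curves must share at least two, and for every later curve a
  point on \<open>X0\<close> and one on \<open>X1\<close>.\<close>

lemma separating_curve:
  assumes tf: "touching_families S1 S2"
    and X01: "X0 \<in> S1" "X1 \<in> S1" "X0 \<noteq> X1" "card (X0 \<inter> X1) \<ge> 2"
    and inX0: "\<And>B. B \<in> S2 \<Longrightarrow> B \<subseteq> X0 \<union> inside X0"
  obtains G where "closed_curve G" "\<And>B. B \<in> S2 \<Longrightarrow> B \<subseteq> G \<union> inside G" "\<And>A. A \<in> S1 \<Longrightarrow> A \<inter> inside G = {}"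
proof -
  note D = touching_familiesD[OF tf]
  have disj: "S1 \<inter> S2 = {}" using touching_families_disjoint[OF tf] .
  have push: "\<exists>G'. closed_curve G' \<and> G' \<subseteq> G \<union> X \<and> inside G' \<subseteq> inside G \<and> X \<inter> inside G' = {} \<and>
        (\<forall>B\<in>S2. B \<subseteq> G' \<union> inside G')"
    if G: "closed_curve G" and GS: "\<And>B. B \<in> S2 \<Longrightarrow> B \<subseteq> G \<union> inside G" and X: "X \<in> S1" and fin: "finite (X \<inter> G)"
      and x12: "x1 \<in> X" "x2 \<in> X" "x1 \<noteq> x2" "x1 \<notin> inside G" "x2 \<notin> inside G" for G X x1 x2
  proof -
    have "\<exists>p. B \<inter> X \<subseteq> {p}" if "B \<in> S2" for B using D(8)[OF X that] by blast
    moreover have "B \<inter> C \<noteq> {} \<and> B \<inter> C \<inter> X = {}" if "B \<in> S2" "C \<in> S2" "B \<noteq> C" for B C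
      using D(5)[of B C X] D(7)[of B C] that X disj by blast
    ultimately show ?thesis
      using push_off_curve[OF G D(3)[OF X] fin x12 D(4) GS, of S2] by metis
  qed
  have "\<exists>G. closed_curve G \<and> G \<subseteq> X0 \<union> X1 \<union> \<Union>F \<and> (\<forall>B\<in>S2. B \<subseteq> G \<union> inside G) \<and>
      (\<forall>A \<in> insert X0 (insert X1 F). A \<inter> inside G = {})"
    if "finite F" "F \<subseteq> S1 - {X0, X1}" for F
    using that
  proof (induction F rule: finite_induct)
    case empty
    have in0: "inside X0 \<inter> X0 = {}" by simp
    obtain x1 x2 where x: "x1 \<in> X0 \<inter> X1" "x2 \<in> X0 \<inter> X1" "x1 \<noteq> x2"
      using X01(4) by (auto simp: numeral_2_eq_2 card_le_Suc_iff)
    have "finite (X1 \<inter> X0)" using D(6) X01 by blast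
    then obtain G where G: "closed_curve G" "G \<subseteq> X0 \<union> X1" "inside G \<subseteq> inside X0" "X1 \<inter> inside G = {}"
      "\<forall>B\<in>S2. B \<subseteq> G \<union> inside G"
      using push[OF D(3)[OF X01(1)] inX0 X01(2), of x1 x2] x in0 by blast
    then show ?case using in0 by (intro exI[of _ G]) blast
  next
    case (insert X F)
    have "F \<subseteq> S1 - {X0, X1}" using insert.prems by simp
    from insert.IH[OF this] obtain G where
      G: "closed_curve G" "G \<subseteq> X0 \<union> X1 \<union> \<Union>F" "\<forall>B\<in>S2. B \<subseteq> G \<union> inside G"
        "\<forall>A \<in> insert X0 (insert X1 F). A \<inter> inside G = {}" by (elim exE conjE)
    have X: "X \<in> S1" "X \<noteq> X0" "X \<noteq> X1" and F: "F \<subseteq> S1" using insert.prems by auto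
    have "finite (X \<inter> Y)" if "Y \<in> insert X0 (insert X1 F)" for Y
      using D(6)[of X Y] that X F X01 insert.hyps by blast
    then have "finite (\<Union>Y\<in>insert X0 (insert X1 F). X \<inter> Y)" using insert.hyps by blast
    moreover have "X \<inter> G \<subseteq> (\<Union>Y\<in>insert X0 (insert X1 F). X \<inter> Y)" using G(2) by blast
    ultimately have fin: "finite (X \<inter> G)" by (rule rev_finite_subset)
    \<comment> \<open>Neither point is inside \<open>G\<close>, because \<open>X0\<close> and
      \<open>X1\<close> are already pushed off; they differ because no three curves share a
      point.\<close>
    obtain x1 where x1: "x1 \<in> X \<inter> X0" using D(7)[of X X0] X X01 by blast
    obtain x2 where x2: "x2 \<in> X \<inter> X1" using D(7)[of X X1] X X01 by blast
    have "x1 \<noteq> x2" using D(5)[of X X0 X1] X X01 x1 x2 by blast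
    then obtain G' where G': "closed_curve G'" "G' \<subseteq> G \<union> X" "inside G' \<subseteq> inside G" "X \<inter> inside G' = {}"
        "\<forall>B\<in>S2. B \<subseteq> G' \<union> inside G'"
      using push[OF G(1) _ X(1) fin, of x1 x2] G(3,4) x1 x2 by blast
    have "G' \<subseteq> X0 \<union> X1 \<union> \<Union>(insert X F)" using G'(2) G(2) by blast
    moreover have "\<forall>A \<in> insert X0 (insert X1 (insert X F)). A \<inter> inside G' = {}"
      using G'(3,4) G(4) by blast
    ultimately show ?case using G'(1,5) by blast
  qed
  from this[OF finite_Diff[OF D(1)] order_refl]
  obtain G where G: "closed_curve G" "\<forall>B\<in>S2. B \<subseteq> G \<union> inside G"
      "\<forall>A \<in> insert X0 (insert X1 (S1 - {X0, X1})). A \<inter> inside G = {}" by (elim exE conjE)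
  have "A \<in> insert X0 (insert X1 (S1 - {X0, X1}))" if "A \<in> S1" for A using that by blast
  then show ?thesis using that[of G] G by blast
qed

text \<open>A closed curve minus one point is connected, so each \<open>B\<close> lies on one side
  of \<open>A\<close>. Two curves on different sides could meet only on \<open>A\<close>, which
  would be a triple point.\<close>

lemma all_on_one_side:
  assumes A: "closed_curve A"
    and S: "\<And>B. B \<in> S \<Longrightarrow> closed_curve B" "\<And>B. B \<in> S \<Longrightarrow> \<exists>p. A \<inter> B \<subseteq> {p}"
      "\<And>B C. B \<in> S \<Longrightarrow> C \<in> S \<Longrightarrow> B \<noteq> C \<Longrightarrow> B \<inter> C \<noteq> {} \<and> A \<inter> B \<inter> C = {}"
  shows "\<exists>K \<in> closed_sides A. \<forall>B\<in>S. B \<subseteq> K"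
proof -
  have side: "B - A \<subseteq> inside A \<or> B - A \<subseteq> outside A" if B: "B \<in> S" for B
  proof -
    obtain p where p: "A \<inter> B \<subseteq> {p}" using S(2)[OF B] by blast
    have "B - A = B - {p} \<or> B - A = B" using p by blast
    then have "connected (B - A)"
      using closed_curve_delete_connected[OF S(1)[OF B]] closed_curve_Jordan(2)[OF S(1)[OF B]] by metis
    then show ?thesis
      using inside_outside_intersect_connected[of "B - A" A] inside_Un_outside[of A] by blast
  qed
  have "(\<forall>B\<in>S. B - A \<subseteq> inside A) \<or> (\<forall>B\<in>S. B - A \<subseteq> outside A)"
  proof (rule ccontr)
    assume "\<not> ?thesis"
    then obtain B C where BC: "B \<in> S" "\<not> B - A \<subseteq> inside A" "C \<in> S" "\<not> C - A \<subseteq> outside A"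
      by blast
    then have "B - A \<subseteq> outside A" "C - A \<subseteq> inside A" using side by blast+
    then have "B \<inter> C \<subseteq> A" "B \<noteq> C" using inside_Int_outside[of A] BC by blast+
    then show False using S(3)[OF BC(1,3)] by blast
  qed
  then show ?thesis
  proof
    assume "\<forall>B\<in>S. B - A \<subseteq> inside A"
    then have "\<forall>B\<in>S. B \<subseteq> A \<union> inside A" by blast
    then show ?thesis by (simp add: closed_sides_def)
  next
    assume "\<forall>B\<in>S. B - A \<subseteq> outside A"
    then have "\<forall>B\<in>S. B \<subseteq> A \<union> outside A" by blast
    then show ?thesis by (simp add: closed_sides_def)
  qed
qed

section \<open>Five pairwise touching curves\<close>

lemma closed_curve_path_avoiding:
  assumes "closed_curve A" "a \<in> A" "b \<in> A" "a \<noteq> b" "z \<noteq> a" "z \<noteq> b"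
  obtains P where "path P" "pathstart P = a" "pathfinish P = b" "path_image P \<subseteq> A - {z}"
proof -
  obtain c1 c2 where c: "arc c1" "pathstart c1 = a" "pathfinish c1 = b"
    "arc c2" "pathstart c2 = a" "pathfinish c2 = b"
    "path_image c1 \<union> path_image c2 = A" "path_image c1 \<inter> path_image c2 = {a, b}"
    using closed_curve_splitE[OF assms(1-4)] by metis
  have "z \<notin> path_image c1 \<or> z \<notin> path_image c2" using c(8) assms(5,6) by blast
  then show ?thesis
    using that[of c1] that[of c2] c arc_imp_path by blast
qed

definition meet :: "complex set \<Rightarrow> complex set \<Rightarrow> complex" where
  "meet A B = the_elem (A \<inter> B)"

lemma meet_commute: "meet A B = meet B A"
  by (simp add: meet_def Int_commute)

text \<open>The parametrization may run in either direction, so this expresses that the pairs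
  \<open>x\<close>, \<open>z\<close> and \<open>y\<close>, \<open>w\<close> interlace on
  \<open>A\<close>.\<close>

definition cyclic_order :: "complex set \<Rightarrow> complex \<Rightarrow> complex \<Rightarrow> complex \<Rightarrow> complex \<Rightarrow> bool" where
  "cyclic_order A x y z w \<longleftrightarrow> (\<exists>g u v s. simple_path g \<and> pathfinish g = pathstart g \<and> path_image g = A \<and>
     0 < u \<and> u < v \<and> v < s \<and> s < 1 \<and> g 0 = x \<and> g u = y \<and> g v = z \<and> g s = w)"

lemma cyclic_order_reverse:
  assumes "cyclic_order A x y z w"
  shows "cyclic_order A x w z y"
proof -
  obtain g u v s where g: "simple_path g" "pathfinish g = pathstart g" "path_image g = A"
     "0 < u" "u < v" "v < s" "s < 1" "g 0 = x" "g u = y" "g v = z" "g s = w"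
    using assms unfolding cyclic_order_def by blast
  have "simple_path (reversepath g)" using g(1) by (rule simple_path_reversepath)
  moreover have "pathfinish (reversepath g) = pathstart (reversepath g)" "path_image (reversepath g) = A"
    using g(2,3) by auto
  moreover have "0 < 1 - s" "1 - s < 1 - v" "1 - v < 1 - u" "1 - u < 1" using g(4-7) by auto
  moreover have "reversepath g 0 = x" "reversepath g (1 - s) = w" "reversepath g (1 - v) = z"
    "reversepath g (1 - u) = y"
    using g(2,8-11) by (auto simp: reversepath_def pathstart_def pathfinish_def)
  ultimately show ?thesis unfolding cyclic_order_def by blast
qed

lemma cyclic_order_cases:
  assumes A: "closed_curve A" "x \<in> A" "y \<in> A" "z \<in> A" "w \<in> A"
    and neq: "x \<noteq> y" "x \<noteq> z" "x \<noteq> w" "y \<noteq> z" "y \<noteq> w" "z \<noteq> w"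
  obtains "cyclic_order A x y z w" | "cyclic_order A x z y w" | "cyclic_order A x y w z"
proof -
  obtain g where g: "simple_path g" "pathfinish g = pathstart g" "path_image g = A" "g 0 = x" "g 1 = x"
    using closed_curve_startE[OF A(1,2)] .
  have param: "\<exists>t. 0 < t \<and> t < 1 \<and> g t = p" if p: "p \<in> A" "p \<noteq> x" for p
  proof -
    obtain t where t: "0 \<le> t" "t \<le> 1" "g t = p" using p(1) g(3) by (auto simp: path_image_def)
    then have "t \<noteq> 0" "t \<noteq> 1" using p(2) g(4,5) by auto
    then show ?thesis using t by (intro exI[of _ t]) auto
  qed
  obtain ty where y: "0 < ty" "ty < 1" "g ty = y" using param[OF A(3)] neq(1) by metis
  obtain tz where z: "0 < tz" "tz < 1" "g tz = z" using param[OF A(4)] neq(2) by metis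
  obtain tw where w: "0 < tw" "tw < 1" "g tw = w" using param[OF A(5)] neq(3) by metis
  have ord: "cyclic_order A x (g a) (g b) (g c)" if "0 < a" "a < b" "b < c" "c < 1" for a b c
    unfolding cyclic_order_def using g(1-4) that by blast
  have "ty \<noteq> tz" "ty \<noteq> tw" "tz \<noteq> tw" using neq(4-6) y z w by auto
  \<comment> \<open>The six linear orders of the remaining points fall into three classes under
    reversal, one for each point that can be opposite to \<open>x\<close>.\<close>
  then consider "ty < tz" "tz < tw" | "tw < tz" "tz < ty" | "tz < ty" "ty < tw" | "tw < ty" "ty < tz"
    | "ty < tw" "tw < tz" | "tz < tw" "tw < ty"
    by linarith
  then show ?thesis
  proof cases
    case 1 then show ?thesis using ord[of ty tz tw] y z w that(1) by simp
  next
    case 2 then show ?thesis using ord[of tw tz ty] y z w that(1) cyclic_order_reverse by simp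
  next
    case 3 then show ?thesis using ord[of tz ty tw] y z w that(2) by simp
  next
    case 4 then show ?thesis using ord[of tw ty tz] y z w that(2) cyclic_order_reverse by simp
  next
    case 5 then show ?thesis using ord[of ty tw tz] y z w that(3) by simp
  next
    case 6 then show ?thesis using ord[of tz tw ty] y z w that(3) cyclic_order_reverse by simp
  qed
qed

text \<open>Neighbours in the cyclic order are joined by an arc that avoids the other two points.
  These arcs later refute unwanted orders.\<close>

lemma cyclic_order_adjacent_connected:
  assumes "cyclic_order A x y z w"
  shows "\<exists>Q. connected Q \<and> Q \<subseteq> A \<and> x \<in> Q \<and> y \<in> Q \<and> z \<notin> Q \<and> w \<notin> Q"
    "\<exists>Q. connected Q \<and> Q \<subseteq> A \<and> y \<in> Q \<and> z \<in> Q \<and> x \<notin> Q \<and> w \<notin> Q"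
proof -
  obtain g u v s where g: "simple_path g" "pathfinish g = pathstart g" "path_image g = A"
     "0 < u" "u < v" "v < s" "s < 1" "g 0 = x" "g u = y" "g v = z" "g s = w"
    using assms unfolding cyclic_order_def by blast
  have conn: "connected (g ` {a..b}) \<and> g ` {a..b} \<subseteq> A" if "0 \<le> a" "b \<le> 1" for a b
  proof -
    have "continuous_on {a..b} g"
      by (rule continuous_on_subset[of "{0..1}"]) (use g(1) that in \<open>auto simp: simple_path_def path_def\<close>)
    then have "connected (g ` {a..b})" by (rule connected_continuous_image) simp
    moreover have "g ` {a..b} \<subseteq> g ` {0..1}" using that by (intro image_mono) auto
    ultimately show ?thesis using g(3) by (simp add: path_image_def)
  qed
  have notin: "g t \<notin> g ` {a..b}" if "0 \<le> a" "b < 1" "0 \<le> t" "t < 1" "t < a \<or> b < t" for t a b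
  proof
    assume "g t \<in> g ` {a..b}"
    then obtain r where r: "a \<le> r" "r \<le> b" "g t = g r" by auto
    then have "t = r" using simple_path_eqD[OF g(1) r(3)] that by auto
    then show False using r that by auto
  qed
  show "\<exists>Q. connected Q \<and> Q \<subseteq> A \<and> x \<in> Q \<and> y \<in> Q \<and> z \<notin> Q \<and> w \<notin> Q"
    using conn[of 0 u] notin[of 0 u v] notin[of 0 u s] g(4-11) by (intro exI[of _ "g ` {0..u}"]) auto
  show "\<exists>Q. connected Q \<and> Q \<subseteq> A \<and> y \<in> Q \<and> z \<in> Q \<and> x \<notin> Q \<and> w \<notin> Q"
    using conn[of u v] notin[of u v 0] notin[of u v s] g(4-11) by (intro exI[of _ "g ` {u..v}"]) auto
qed

context
  fixes S :: "complex set set"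
  assumes curves: "\<And>A. A \<in> S \<Longrightarrow> closed_curve A"
    and single: "\<And>A B. A \<in> S \<Longrightarrow> B \<in> S \<Longrightarrow> A \<noteq> B \<Longrightarrow> \<exists>p. A \<inter> B = {p}"
    and triple: "\<And>A B C. A \<in> S \<Longrightarrow> B \<in> S \<Longrightarrow> C \<in> S \<Longrightarrow> A \<noteq> B \<Longrightarrow> A \<noteq> C \<Longrightarrow> B \<noteq> C \<Longrightarrow> A \<inter> B \<inter> C = {}"
begin

lemma Int_eq_meet:
  assumes "A \<in> S" "B \<in> S" "A \<noteq> B"
  shows "A \<inter> B = {meet A B}"
proof -
  obtain p where "A \<inter> B = {p}" using single[OF assms] ..
  then show ?thesis by (simp add: meet_def)
qed

lemma meet_in: "A \<in> S \<Longrightarrow> B \<in> S \<Longrightarrow> A \<noteq> B \<Longrightarrow> meet A B \<in> A \<and> meet A B \<in> B"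
  using Int_eq_meet by blast

lemma meet_neq:
  "A \<in> S \<Longrightarrow> B \<in> S \<Longrightarrow> C \<in> S \<Longrightarrow> A \<noteq> B \<Longrightarrow> A \<noteq> C \<Longrightarrow> B \<noteq> C \<Longrightarrow> meet A B \<noteq> meet A C"
  using triple[of A B C] meet_in[of A B] meet_in[of A C] by auto

text \<open>The path follows \<open>B\<close> to \<open>D\<close> and then \<open>D\<close> back to
  \<open>A\<close>. On each of the two curves one of the two available arcs avoids the single point
  shared with \<open>C\<close>.\<close>

lemma path_through_two_curves:
  assumes S: "A \<in> S" "B \<in> S" "C \<in> S" "D \<in> S" and neq: "distinct [A, B, C, D]"
  obtains P where "path P" "pathstart P = meet A B" "pathfinish P = meet A D"
    "path_image P \<subseteq> B \<union> D" "path_image P \<inter> C = {}"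
proof -
  have n: "A \<noteq> B" "A \<noteq> C" "A \<noteq> D" "B \<noteq> C" "B \<noteq> D" "C \<noteq> D" using neq by auto
  obtain P1 where P1: "path P1" "pathstart P1 = meet B A" "pathfinish P1 = meet B D"
      "path_image P1 \<subseteq> B - {meet B C}"
    using closed_curve_path_avoiding[OF curves[OF S(2)], of "meet B A" "meet B D" "meet B C"]
      meet_in[of B A] meet_in[of B D] meet_neq[of B A D] meet_neq[of B C A] meet_neq[of B C D] S n by metis
  obtain P2 where P2: "path P2" "pathstart P2 = meet D B" "pathfinish P2 = meet D A"
      "path_image P2 \<subseteq> D - {meet D C}"
    using closed_curve_path_avoiding[OF curves[OF S(4)], of "meet D B" "meet D A" "meet D C"]
      meet_in[of D A] meet_in[of D B] meet_neq[of D B A] meet_neq[of D C A] meet_neq[of D C B] S n by metis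
  have j: "pathfinish P1 = pathstart P2" using P1(3) P2(2) meet_commute by metis
  show ?thesis
  proof
    show "path (P1 +++ P2)" using P1(1) P2(1) j by simp
    show "pathstart (P1 +++ P2) = meet A B" "pathfinish (P1 +++ P2) = meet A D"
      using P1(2) P2(3) meet_commute by auto
    show "path_image (P1 +++ P2) \<subseteq> B \<union> D" using P1(4) P2(4) path_image_join[OF j] by blast
    have "path_image P1 \<inter> C = {}" using P1(4) Int_eq_meet[of B C] S n by blast
    moreover have "path_image P2 \<inter> C = {}" using P2(4) Int_eq_meet[of D C] S n by blast
    ultimately show "path_image (P1 +++ P2) \<inter> C = {}" using path_image_join[OF j] by blast
  qed
qed

lemma common_side:
  assumes "A \<in> S"
  obtains K where "K \<in> closed_sides A" "\<And>B. B \<in> S \<Longrightarrow> B \<noteq> A \<Longrightarrow> B \<subseteq> K"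
proof -
  have "\<exists>K \<in> closed_sides A. \<forall>B\<in>S - {A}. B \<subseteq> K"
  proof (rule all_on_one_side)
    show "\<exists>p. A \<inter> B \<subseteq> {p}" if "B \<in> S - {A}" for B using single[of A B] assms that by blast
    show "B \<inter> C \<noteq> {} \<and> A \<inter> B \<inter> C = {}" if "B \<in> S - {A}" "C \<in> S - {A}" "B \<noteq> C" for B C
      using single[of B C] triple[of A B C] assms that by blast
  qed (use curves assms in auto)
  then show ?thesis using that by blast
qed

text \<open>A path from \<open>A\<close> to \<open>A\<close> through \<open>B\<close> and
  \<open>D\<close> and the connected set \<open>C \<union> Q\<close> are chords of \<open>A\<close>
  on the same side with interlacing ends, so they meet. The path avoids \<open>C\<close>, hence it
  meets \<open>Q\<close> where \<open>E\<close> meets \<open>B\<close> or \<open>D\<close>.\<close>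

lemma separation_on_fourth:
  assumes S: "A \<in> S" "B \<in> S" "C \<in> S" "D \<in> S" "E \<in> S" and neq: "distinct [A, B, C, D, E]"
    and cyc: "cyclic_order A (meet A B) (meet A C) (meet A D) (meet A E)"
    and Q: "connected Q" "Q \<subseteq> E" "meet E A \<in> Q" "meet E C \<in> Q"
  shows "meet E B \<in> Q \<or> meet E D \<in> Q"
proof -
  have n: "A \<noteq> B" "A \<noteq> C" "A \<noteq> D" "A \<noteq> E" "C \<noteq> E" "B \<noteq> E" "D \<noteq> E" using neq by auto
  obtain K where K: "K \<in> closed_sides A" "\<And>B. B \<in> S \<Longrightarrow> B \<noteq> A \<Longrightarrow> B \<subseteq> K"
    using common_side[OF S(1)] by metis
  have "distinct [A, B, C, D]" using neq by simp
  then obtain P where P: "path P" "pathstart P = meet A B" "pathfinish P = meet A D"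
      "path_image P \<subseteq> B \<union> D" "path_image P \<inter> C = {}"
    by (rule path_through_two_curves[OF S(1-4)])
  obtain g u v s where g: "simple_path g" "pathfinish g = pathstart g" "path_image g = A"
     "0 < u" "u < v" "v < s" "s < 1" "g 0 = meet A B" "g u = meet A C" "g v = meet A D" "g s = meet A E"
    using cyc unfolding cyclic_order_def by blast
  have "connected (C \<union> Q)"
    using closed_curve_Jordan(2)[OF curves[OF S(3)]] Q(1,4) meet_in[of E C] S n
    by (intro connected_Un) auto
  moreover have "path_image P \<subseteq> K" using P(4) K(2) S n by blast
  moreover have "C \<union> Q \<subseteq> K" using Q(2) K(2) S n by blast
  moreover have "g u \<in> C \<union> Q" "g s \<in> C \<union> Q"
    using meet_in[of A C] S n g(9,11) Q(3) meet_commute by auto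
  ultimately have "path_image P \<inter> (C \<union> Q) \<noteq> {}"
    by (intro chords_intersect[OF g(1,2), of K 0 u v s]) (use K(1) P(1-3) g(3-10) in simp_all)
  then obtain x where x: "x \<in> path_image P" "x \<in> Q" using P(5) by blast
  then have "x \<in> E \<inter> B \<or> x \<in> E \<inter> D" using Q(2) P(4) by blast
  then show ?thesis
    unfolding Int_eq_meet[OF S(5,2) n(6)[symmetric]] Int_eq_meet[OF S(5,4) n(7)[symmetric]]
    using x(2) by auto
qed

text \<open>The same argument with the other pair of chords: a path through \<open>C\<close> and
  \<open>E\<close> that avoids \<open>D\<close>, against the connected set
  \<open>D \<union> Q\<close>.\<close>

lemma separation_on_first:
  assumes S: "A \<in> S" "B \<in> S" "C \<in> S" "D \<in> S" "E \<in> S" and neq: "distinct [A, B, C, D, E]"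
    and cyc: "cyclic_order A (meet A B) (meet A C) (meet A D) (meet A E)"
    and Q: "connected Q" "Q \<subseteq> B" "meet B A \<in> Q" "meet B D \<in> Q"
  shows "meet B C \<in> Q \<or> meet B E \<in> Q"
proof -
  have n: "A \<noteq> B" "A \<noteq> C" "A \<noteq> D" "A \<noteq> E" "B \<noteq> C" "B \<noteq> D" "B \<noteq> E" using neq by auto
  obtain K where K: "K \<in> closed_sides A" "\<And>B. B \<in> S \<Longrightarrow> B \<noteq> A \<Longrightarrow> B \<subseteq> K"
    using common_side[OF S(1)] by metis
  have "distinct [A, C, D, E]" using neq by simp
  then obtain P where P: "path P" "pathstart P = meet A C" "pathfinish P = meet A E"
      "path_image P \<subseteq> C \<union> E" "path_image P \<inter> D = {}"
    by (rule path_through_two_curves[OF S(1,3-5)])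
  obtain g u v s where g: "simple_path g" "pathfinish g = pathstart g" "path_image g = A"
     "0 < u" "u < v" "v < s" "s < 1" "g 0 = meet A B" "g u = meet A C" "g v = meet A D" "g s = meet A E"
    using cyc unfolding cyclic_order_def by blast
  have "connected (D \<union> Q)"
    using closed_curve_Jordan(2)[OF curves[OF S(4)]] Q(1,4) meet_in[of B D] S n
    by (intro connected_Un) auto
  moreover have "path_image P \<subseteq> K" using P(4) K(2) S n by blast
  moreover have "D \<union> Q \<subseteq> K" using Q(2) K(2) S n by blast
  moreover have "g 0 \<in> D \<union> Q" "g v \<in> D \<union> Q"
    using meet_in[of A D] S n g(8,10) Q(3) meet_commute by auto
  ultimately have "path_image P \<inter> (D \<union> Q) \<noteq> {}"
    by (intro chord_base[OF g(1,2), of K u v s]) (use K(1) P(1-3) g(3-11) in simp_all)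
  then obtain x where x: "x \<in> path_image P" "x \<in> Q" using P(5) by blast
  then have "x \<in> B \<inter> C \<or> x \<in> B \<inter> E" using Q(2) P(4) by blast
  then show ?thesis
    unfolding Int_eq_meet[OF S(2,3) n(5)] Int_eq_meet[OF S(2,5) n(7)] using x(2) by auto
qed

text \<open>Writing \<open>B D | C E\<close> on \<open>A\<close> for interlacing touching points, the order \<open>B D | C E\<close> on \<open>A\<close>
  forces \<open>A C | B D\<close> on \<open>E\<close> and \<open>A D | C E\<close> on \<open>B\<close>; the latter forces \<open>B C | A D\<close> on \<open>E\<close>.\<close>

lemma no_cyclic_order:
  assumes S: "A \<in> S" "B \<in> S" "C \<in> S" "D \<in> S" "E \<in> S" and neq: "distinct [A, B, C, D, E]"
    and cyc: "cyclic_order A (meet A B) (meet A C) (meet A D) (meet A E)"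
  shows False
proof -
  have n: "A \<noteq> B" "A \<noteq> C" "A \<noteq> D" "A \<noteq> E" "B \<noteq> C" "B \<noteq> D" "B \<noteq> E" "C \<noteq> D" "C \<noteq> E" "D \<noteq> E"
    using neq by auto
  \<comment> \<open>In both competing orders \<open>x\<close> and \<open>z\<close> are neighbours,
    and the arc between them would contradict the separation property.\<close>
  have sep: "cyclic_order X x y z w"
    if X: "X \<in> S" "x \<in> X" "y \<in> X" "z \<in> X" "w \<in> X"
      and d: "x \<noteq> y" "x \<noteq> z" "x \<noteq> w" "y \<noteq> z" "y \<noteq> w" "z \<noteq> w"
      and s: "\<And>Q. connected Q \<Longrightarrow> Q \<subseteq> X \<Longrightarrow> x \<in> Q \<Longrightarrow> z \<in> Q \<Longrightarrow> y \<in> Q \<or> w \<in> Q" for X x y z w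
  proof (rule cyclic_order_cases[OF curves[OF X(1)] X(2-5) d])
    assume "cyclic_order X x z y w"
    then show ?thesis using cyclic_order_adjacent_connected(1) s by metis
  next
    assume "cyclic_order X x y w z"
    then show ?thesis using cyclic_order_adjacent_connected(1)[OF cyclic_order_reverse] s by metis
  qed
  have "cyclic_order B (meet B A) (meet B C) (meet B D) (meet B E)"
  proof (rule sep)
    show "meet B C \<in> Q \<or> meet B E \<in> Q"
      if "connected Q" "Q \<subseteq> B" "meet B A \<in> Q" "meet B D \<in> Q" for Q
      using separation_on_first[OF S neq cyc that] .
  qed (use S n meet_in[of B] meet_neq[of B] in auto)
  \<comment> \<open>Here \<open>A\<close> and \<open>B\<close> exchange roles: the order just found
    on \<open>B\<close> is the hypothesis of \<open>separation_on_fourth\<close>.\<close>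
  then have E2: "meet E A \<in> Q \<or> meet E D \<in> Q"
    if "connected Q" "Q \<subseteq> E" "meet E B \<in> Q" "meet E C \<in> Q" for Q
    using separation_on_fourth[of B A C D E Q] S n that by auto
  have "cyclic_order E (meet E A) (meet E B) (meet E C) (meet E D)"
  proof (rule sep)
    show "meet E B \<in> Q \<or> meet E D \<in> Q"
      if "connected Q" "Q \<subseteq> E" "meet E A \<in> Q" "meet E C \<in> Q" for Q
      using separation_on_fourth[OF S neq cyc that] .
  qed (use S n meet_in[of E] meet_neq[of E] in auto)
  \<comment> \<open>On \<open>E\<close> the points of \<open>B\<close> and \<open>C\<close> are
    neighbours, so an arc joins them while avoiding those of \<open>A\<close> and \<open>D\<close>,
    against \<open>E2\<close>.\<close>
  from cyclic_order_adjacent_connected(2)[OF this] E2 show False by blast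
qed

lemma five_touching_curves:
  assumes S: "A \<in> S" "B \<in> S" "C \<in> S" "D \<in> S" "E \<in> S" and neq: "distinct [A, B, C, D, E]"
  shows False
proof -
  have n: "A \<noteq> B" "A \<noteq> C" "A \<noteq> D" "A \<noteq> E" "B \<noteq> C" "B \<noteq> D" "B \<noteq> E" "C \<noteq> D" "C \<noteq> E" "D \<noteq> E"
    using neq by auto
  have m: "meet A B \<in> A" "meet A C \<in> A" "meet A D \<in> A" "meet A E \<in> A" using meet_in[of A] S n by auto
  have d: "meet A B \<noteq> meet A C" "meet A B \<noteq> meet A D" "meet A B \<noteq> meet A E" "meet A C \<noteq> meet A D"
    "meet A C \<noteq> meet A E" "meet A D \<noteq> meet A E"
    using meet_neq[of A] S n by auto
  show False
    by (rule cyclic_order_cases[OF curves[OF S(1)] m d])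
      (use no_cyclic_order[of A B C D E] no_cyclic_order[of A B D C E] no_cyclic_order[of A B C E D] S n in auto)
qed

end

section \<open>Alternations and intersection points\<close>

text \<open>The labels number the arcs into which \<open>Y\<close> cuts a parametrization of \<open>X\<close>.\<close>

lemma component_labels:
  assumes X: "closed_curve X" and fin: "finite (X \<inter> Y)"
  obtains l :: "complex \<Rightarrow> nat" where "\<And>x. l x < card (X \<inter> Y) + 2"
    "\<And>x x'. x \<in> X - Y \<Longrightarrow> x' \<in> X - Y \<Longrightarrow> l x = l x' \<Longrightarrow>
       \<exists>P. path P \<and> pathstart P = x \<and> pathfinish P = x' \<and> path_image P \<subseteq> X - Y"
proof -
  obtain h where h: "simple_path h" "pathfinish h = pathstart h" "path_image h = X"
    using X by (auto simp: closed_curve_def)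
  have hX: "h t \<in> X" if "0 \<le> t" "t \<le> 1" for t
    using h(3) that by (auto simp: path_image_def)
  define T where "T = {t \<in> {0..1}. h t \<in> Y}"
  have inj: "inj_on h (T - {1})"
    by (rule inj_onI) (auto simp: T_def intro: simple_path_eqD[OF h(1)])
  have sub: "h ` (T - {1}) \<subseteq> X \<inter> Y" by (auto simp: T_def intro: hX)
  have "finite (T - {1})"
    by (rule finite_imageD[OF finite_subset[OF sub fin] inj])
  then have finT: "finite T" by simp
  have "card (T - {1}) \<le> card (X \<inter> Y)" by (rule card_inj_on_le[OF inj sub fin])
  \<comment> \<open>One more than the number of points, because the base point of the
    parametrization may be hit at both 0 and 1.\<close>
  then have cT: "card T \<le> card (X \<inter> Y) + 1" using card_Diff1_le[of T 1] card_Diff_singleton_if[of T 1]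
    by (auto split: if_splits)
  have "\<exists>t. 0 \<le> t \<and> t \<le> 1 \<and> h t = x" if "x \<in> X" for x
    using that h(3) by (auto simp: path_image_def)
  then obtain \<tau> where \<tau>: "\<And>x. x \<in> X \<Longrightarrow> 0 \<le> \<tau> x \<and> \<tau> x \<le> 1 \<and> h (\<tau> x) = x" by metis
  \<comment> \<open>The label counts the cut parameters before \<open>x\<close>. It can take any
    value from 0 to \<open>card T\<close>, which gives the summand 2 in the bound.\<close>
  define l where "l x = card {s \<in> T. s < \<tau> x}" for x
  have free: "h ` {\<tau> x..\<tau> x'} \<subseteq> X - Y"
    if x: "x \<in> X - Y" "x' \<in> X - Y" and eq: "l x = l x'" and le: "\<tau> x \<le> \<tau> x'" for x x'
  proof
    fix p assume "p \<in> h ` {\<tau> x..\<tau> x'}"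
    then obtain t where t: "\<tau> x \<le> t" "t \<le> \<tau> x'" "p = h t" by auto
    have t01: "0 \<le> t" "t \<le> 1" using t \<tau>[of x] \<tau>[of x'] x by auto
    \<comment> \<open>The two sets are nested and equally large, hence equal: no cut lies between
      the two parameters.\<close>
    have same: "{s \<in> T. s < \<tau> x} = {s \<in> T. s < \<tau> x'}"
      using eq le finT unfolding l_def by (intro card_subset_eq) auto
    have "\<tau> x' \<notin> T" using x \<tau>[of x'] by (auto simp: T_def)
    have "t \<notin> T"
    proof
      assume "t \<in> T"
      then have "t < \<tau> x'" using \<open>\<tau> x' \<notin> T\<close> t(2) by (auto simp: order_le_less)
      then have "t \<in> {s \<in> T. s < \<tau> x}" unfolding same using \<open>t \<in> T\<close> by simp
      then show False using t(1) by simp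
    qed
    then show "p \<in> X - Y" using t t01 hX by (auto simp: T_def)
  qed
  show ?thesis
  proof
    fix x
    have "l x \<le> card T" unfolding l_def using finT by (intro card_mono) auto
    then show "l x < card (X \<inter> Y) + 2" using cT by linarith
  next
    fix x x' assume x: "x \<in> X - Y" "x' \<in> X - Y" "l x = l x'"
    define P where "P = subpath (\<tau> x) (\<tau> x') h"
    have \<tau>x: "\<tau> x \<in> {0..1}" "\<tau> x' \<in> {0..1}" "h (\<tau> x) = x" "h (\<tau> x') = x'" using x \<tau> by auto
    have "path P" unfolding P_def using h(1) \<tau>x by (auto simp: simple_path_def)
    moreover have "pathstart P = x" "pathfinish P = x'" unfolding P_def using \<tau>x by auto
    moreover have "path_image P \<subseteq> X - Y"
      unfolding P_def path_image_subpath using free[OF x] free[OF x(2,1) x(3)[symmetric]] by auto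
    ultimately show "\<exists>P. path P \<and> pathstart P = x \<and> pathfinish P = x' \<and> path_image P \<subseteq> X - Y" by blast
  qed
qed

text \<open>Each alternation is charged to a piece of \<open>X - Y\<close> or of
  \<open>Y - X\<close>. Take a position \<open>t\<close> of \<open>X\<close> and the last position
  of \<open>Y\<close> before it. If the piece of \<open>X\<close> had been visited before and the
  piece of \<open>Y\<close> were visited again later, two disjoint chords would interlace. So
  \<open>t\<close> is the first visit to its piece or the other position is the last visit to its
  piece, and each piece is charged at most once.\<close>

lemma alternations_le_intersections:
  fixes \<tau> :: "nat \<Rightarrow> real"
  assumes g: "simple_path g" "pathfinish g = pathstart g" and K: "K \<in> closed_sides (path_image g)"
    and X: "closed_curve X" "X \<subseteq> K" and Y: "closed_curve Y" "Y \<subseteq> K"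
    and neq: "X \<noteq> Y" and fin: "finite (X \<inter> Y)"
    and \<tau>: "\<And>s t. s < t \<Longrightarrow> t < N \<Longrightarrow> \<tau> s < \<tau> t" "\<And>t. t < N \<Longrightarrow> 0 \<le> \<tau> t \<and> \<tau> t < 1"
    and rX: "\<And>t. t < N \<Longrightarrow> r t = X \<Longrightarrow> g (\<tau> t) \<in> X - Y"
    and rY: "\<And>t. t < N \<Longrightarrow> r t = Y \<Longrightarrow> g (\<tau> t) \<in> Y - X"
  shows "card {t \<in> {..<N}. r t = X \<and> Y \<in> seen_since r t} \<le> 2 * card (X \<inter> Y) + 4"
proof -
  obtain lx where lx: "\<And>x. lx x < card (X \<inter> Y) + 2"
    "\<And>x x'. x \<in> X - Y \<Longrightarrow> x' \<in> X - Y \<Longrightarrow> lx x = lx x' \<Longrightarrow>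
       \<exists>P. path P \<and> pathstart P = x \<and> pathfinish P = x' \<and> path_image P \<subseteq> X - Y"
    using component_labels[OF X(1) fin] by blast
  obtain ly where ly: "\<And>x. ly x < card (X \<inter> Y) + 2"
    "\<And>x x'. x \<in> Y - X \<Longrightarrow> x' \<in> Y - X \<Longrightarrow> ly x = ly x' \<Longrightarrow>
       \<exists>P. path P \<and> pathstart P = x \<and> pathfinish P = x' \<and> path_image P \<subseteq> Y - X"
    using component_labels[OF Y(1), of X] fin by (metis Int_commute)
  define p where "p t = g (\<tau> t)" for t
  define Gset where "Gset = {t \<in> {..<N}. r t = X \<and> Y \<in> seen_since r t}"
  define q where "q t = Max {s. s < t \<and> r s = Y}" for t
  have q: "q t < t \<and> r (q t) = Y \<and> (\<forall>s. q t < s \<and> s < t \<longrightarrow> r s \<noteq> X \<and> r s \<noteq> Y)" if t: "t \<in> Gset" for t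
  proof -
    have rt: "r t = X" using t by (simp add: Gset_def)
    obtain q0 where q0: "q0 < t" "r q0 = Y" "\<And>s. q0 < s \<Longrightarrow> s < t \<Longrightarrow> r s \<noteq> X"
      using t rt by (auto simp: Gset_def seen_since_def)
    have f: "finite {s. s < t \<and> r s = Y}" by simp
    have "q t \<in> {s. s < t \<and> r s = Y}" unfolding q_def by (rule Max_in[OF f]) (use q0 in auto)
    moreover have le: "s \<le> q t" if "s < t" "r s = Y" for s
      unfolding q_def by (rule Max_ge[OF f]) (use that in simp)
    moreover have "q0 \<le> q t" using le q0 by blast
    ultimately show ?thesis using q0(3) by (metis (mono_tags, lifting) leD le_less_trans mem_Collect_eq)
  qed
  have qN: "q t < N" "t < N" "r t = X" if "t \<in> Gset" for t
    using q[OF that] that by (auto simp: Gset_def)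
  \<comment> \<open>No \<open>X\<close> lies strictly between \<open>q t\<close> and
    \<open>t\<close>, so \<open>q t\<close> determines \<open>t\<close> as the next position of
    \<open>X\<close>.\<close>
  have q_inj: "t = t'" if "t \<in> Gset" "t' \<in> Gset" "q t = q t'" for t t'
    using q[OF that(1)] q[OF that(2)] qN(3)[OF that(1)] qN(3)[OF that(2)] that(3)
    by (metis linorder_neqE_nat)
  have no_interlacing: False
    if ord: "i < j" "j < k" "k < m" "m < N" and rr: "r i = X" "r j = Y" "r k = X" "r m = Y"
      and eqs: "lx (p i) = lx (p k)" "ly (p j) = ly (p m)" for i j k m
  proof -
    have pX: "p i \<in> X - Y" "p k \<in> X - Y" and pY: "p j \<in> Y - X" "p m \<in> Y - X"
      unfolding p_def using rX rY rr ord by auto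
    obtain P where P: "path P" "pathstart P = p i" "pathfinish P = p k" "path_image P \<subseteq> X - Y"
      using lx(2)[OF pX eqs(1)] by blast
    obtain Q where Q: "path Q" "pathstart Q = p j" "pathfinish Q = p m" "path_image Q \<subseteq> Y - X"
      using ly(2)[OF pY eqs(2)] by blast
    have "path_image P \<inter> path_image Q \<noteq> {}"
    proof (rule chords_intersect[OF g K, of "\<tau> i" "\<tau> j" "\<tau> k" "\<tau> m"])
      show "g (\<tau> j) \<in> path_image Q" "g (\<tau> m) \<in> path_image Q"
        using Q(2,3) pathstart_in_path_image[of Q] pathfinish_in_path_image[of Q] by (auto simp: p_def)
      show "connected (path_image Q)" using Q(1) by (rule connected_path_image)
      show "path_image P \<subseteq> K" "path_image Q \<subseteq> K" using P(4) Q(4) X(2) Y(2) by auto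
    qed (use P \<tau> ord in \<open>auto simp: p_def\<close>)
    then show False using P(4) Q(4) by blast
  qed
  define G1 where "G1 = {t \<in> Gset. \<forall>i<t. r i = X \<longrightarrow> lx (p i) \<noteq> lx (p t)}"
  define G2 where "G2 = {t \<in> Gset. \<forall>m<N. q t < m \<and> r m = Y \<longrightarrow> ly (p (q t)) \<noteq> ly (p m)}"
  have "Gset \<subseteq> G1 \<union> G2"
  proof
    fix t assume t: "t \<in> Gset"
    show "t \<in> G1 \<union> G2"
    proof (rule ccontr)
      assume no: "t \<notin> G1 \<union> G2"
      then obtain i where i: "i < t" "r i = X" "lx (p i) = lx (p t)" using t by (auto simp: G1_def)
      obtain m where m: "m < N" "q t < m" "r m = Y" "ly (p (q t)) = ly (p m)" using no t by (auto simp: G2_def)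
      note qt = q[OF t]
      \<comment> \<open>Neither curve occurs strictly between \<open>q t\<close> and
        \<open>t\<close>, so the earlier \<open>X\<close> precedes \<open>q t\<close> and the later
        \<open>Y\<close> follows \<open>t\<close>: the four positions interlace.\<close>
      have "i < q t" using i qt neq by (metis linorder_neqE_nat)
      moreover have "t < m" using m qt qN(3)[OF t] neq by (metis linorder_neqE_nat)
      ultimately show False
        using no_interlacing[of i "q t" t m] i m qt qN(3)[OF t] by blast
    qed
  qed
  moreover have "card G1 \<le> card (X \<inter> Y) + 2"
  proof -
    have "inj_on (\<lambda>t. lx (p t)) G1"
    proof (rule inj_onI)
      fix s t assume st: "s \<in> G1" "t \<in> G1" "lx (p s) = lx (p t)"
      then have G: "r s = X" "r t = X" using qN(3) by (auto simp: G1_def)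
      have "\<not> s < t" using st(2,3) G(1) by (auto simp: G1_def)
      moreover have "\<not> t < s" using st(1,3) G(2) by (auto simp: G1_def)
      ultimately show "s = t" by simp
    qed
    then have "card G1 \<le> card {..<card (X \<inter> Y) + 2}"
      by (rule card_inj_on_le) (use lx(1) in auto)
    then show ?thesis by simp
  qed
  moreover have "card G2 \<le> card (X \<inter> Y) + 2"
  proof -
    have "inj_on (\<lambda>t. ly (p (q t))) G2"
    proof (rule inj_onI)
      fix s t assume st: "s \<in> G2" "t \<in> G2" "ly (p (q s)) = ly (p (q t))"
      then have G: "s \<in> Gset" "t \<in> Gset" by (auto simp: G2_def)
      have "\<not> q s < q t" using st(1,3) qN(1)[OF G(2)] q[OF G(2)] unfolding G2_def by blast
      moreover have "\<not> q t < q s"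
      proof
        assume "q t < q s"
        then have "ly (p (q t)) \<noteq> ly (p (q s))" using st(2) qN(1)[OF G(1)] q[OF G(1)] unfolding G2_def by blast
        then show False using st(3) by simp
      qed
      ultimately show "s = t" using q_inj[OF G] by simp
    qed
    then have "card G2 \<le> card {..<card (X \<inter> Y) + 2}"
      by (rule card_inj_on_le) (use ly(1) in auto)
    then show ?thesis by simp
  qed
  moreover have "finite (G1 \<union> G2)" by (simp add: G1_def G2_def Gset_def)
  ultimately have "card Gset \<le> (card (X \<inter> Y) + 2) + (card (X \<inter> Y) + 2)"
    using card_mono[of "G1 \<union> G2" Gset] card_Un_le[of G1 G2] by linarith
  then show ?thesis unfolding Gset_def by simp
qed

section \<open>Counting alternations along the separating curve\<close>

text \<open>The sum runs over ordered pairs, so every unordered pair contributes twice; touching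
  points are included.\<close>

definition pair_count :: "complex set set \<Rightarrow> nat" where
  "pair_count S = (\<Sum>X\<in>S. \<Sum>Y\<in>S - {X}. card (X \<inter> Y))"

text \<open>\<open>S2\<close> lies in the closed disc of the separating curve and \<open>S1\<close>
  avoids its inside, so all points common to the two families are on that curve. Read in the order
  of the parameter they list every pair exactly once, and each family has its own side for the chord
  argument. The summand 8 n^2 collects the additive 4 over the ordered pairs of both
  families.\<close>

lemma pair_count_lower_bound_inside:
  assumes tf: "touching_families S1 S2" and n: "card S1 = n" "card S2 = n" "n > 0"
    and X01: "X0 \<in> S1" "X1 \<in> S1" "X0 \<noteq> X1" "card (X0 \<inter> X1) \<ge> 2"
    and inX0: "\<And>B. B \<in> S2 \<Longrightarrow> B \<subseteq> X0 \<union> inside X0"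
  shows "real (n\<^sup>2) / 8 * ln (real n / 2) \<le> real (2 * pair_count S1 + 2 * pair_count S2 + 8 * n\<^sup>2)"
proof -
  note D = touching_familiesD[OF tf]
  have disj: "S1 \<inter> S2 = {}" using touching_families_disjoint[OF tf] .
  obtain G where G: "closed_curve G" "\<And>B. B \<in> S2 \<Longrightarrow> B \<subseteq> G \<union> inside G"
      "\<And>A. A \<in> S1 \<Longrightarrow> A \<inter> inside G = {}"
    using separating_curve[OF tf X01 inX0] by blast
  obtain g where g: "simple_path g" "pathfinish g = pathstart g" "path_image g = G"
    using G(1) by (auto simp: closed_curve_def)
  have sides: "G \<union> inside G \<in> closed_sides (path_image g)" "G \<union> outside G \<in> closed_sides (path_image g)"
    by (auto simp: closed_sides_def g(3))
  have S1out: "A \<subseteq> G \<union> outside G" if "A \<in> S1" for A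
    using G(3)[OF that] inside_Un_outside[of G] by blast
  have "\<exists>t. 0 \<le> t \<and> t < 1 \<and> g t \<in> A \<and> g t \<in> B" if AB: "A \<in> S1" "B \<in> S2" for A B
  proof -
    obtain x where x: "x \<in> A" "x \<in> B" using D(8)[OF AB] by blast
    then have "x \<in> path_image g" using G(2)[OF AB(2)] G(3)[OF AB(1)] g(3) by blast
    then obtain t where t: "0 \<le> t" "t \<le> 1" "x = g t" by (auto simp: path_image_def)
    show ?thesis
    proof (cases "t = 1")
      case True
      then have "x = g 0" using t(3) g(2) by (simp add: pathstart_def pathfinish_def)
      then show ?thesis using x by (intro exI[of _ 0]) auto
    next
      case False
      then show ?thesis using x t by (intro exI[of _ t]) auto
    qed
  qed
  then obtain \<sigma> where \<sigma>: "\<And>A B. A \<in> S1 \<Longrightarrow> B \<in> S2 \<Longrightarrow> 0 \<le> \<sigma> A B \<and> \<sigma> A B < 1 \<and> g (\<sigma> A B) \<in> A \<and> g (\<sigma> A B) \<in> B"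
    by metis
  \<comment> \<open>A point shared by two different pairs would lie on three curves.\<close>
  have \<sigma>_inj: "A = A' \<and> B = B'"
    if S: "A \<in> S1" "A' \<in> S1" "B \<in> S2" "B' \<in> S2" and eq: "\<sigma> A B = \<sigma> A' B'" for A A' B B'
  proof -
    define x where "x = g (\<sigma> A B)"
    have x: "x \<in> A" "x \<in> B" "x \<in> A'" "x \<in> B'"
      unfolding x_def using \<sigma>[OF S(1,3)] \<sigma>[OF S(2,4)] eq by auto
    have "A \<noteq> B" "A' \<noteq> B" "A \<noteq> B'" using S disj by auto
    then show ?thesis using D(5)[of A A' B] D(5)[of A B B'] S x by blast
  qed
  \<comment> \<open>Sorting the n^2 distinct parameters turns the set of pairs into a sequence:
    \<open>\<tau> t\<close> is the parameter at position \<open>t\<close>, and \<open>r t\<close>,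
    \<open>b t\<close> are its two curves.\<close>
  define \<rho> where "\<rho> = (\<lambda>(A, B). \<sigma> A B)"
  define M where "M = \<rho> ` (S1 \<times> S2)"
  have inj: "inj_on \<rho> (S1 \<times> S2)"
    by (rule inj_onI) (use \<sigma>_inj in \<open>auto simp: \<rho>_def\<close>)
  have M: "finite M" "card M = n\<^sup>2"
    unfolding M_def using D(1,2) n by (auto simp: card_image[OF inj] card_cartesian_product power2_eq_square)
  define xs where "xs = sorted_list_of_set M"
  have xs: "set xs = M" "length xs = n\<^sup>2" "sorted_wrt (<) xs"
    unfolding xs_def using M by (auto simp: strict_sorted_list_of_set)
  define \<tau> where "\<tau> t = xs ! t" for t
  have \<tau>_mono: "\<tau> s < \<tau> t" if "s < t" "t < n\<^sup>2" for s t
    unfolding \<tau>_def using xs(2,3) that by (simp add: sorted_wrt_nth_less)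
  define pr where "pr t = inv_into (S1 \<times> S2) \<rho> (\<tau> t)" for t
  have \<tau>M: "\<tau> t \<in> M" if "t < n\<^sup>2" for t using that xs(1,2) unfolding \<tau>_def by (metis nth_mem)
  have pr: "pr t \<in> S1 \<times> S2" "\<rho> (pr t) = \<tau> t" if "t < n\<^sup>2" for t
    using \<tau>M[OF that] unfolding pr_def M_def by (auto intro: inv_into_into f_inv_into_f)
  define r b where "r t = fst (pr t)" and "b t = snd (pr t)" for t
  have rb: "r t \<in> S1" "b t \<in> S2" "\<sigma> (r t) (b t) = \<tau> t" if "t < n\<^sup>2" for t
    using pr[OF that] by (auto simp: r_def b_def \<rho>_def split: prod.splits)
  have \<tau>01: "0 \<le> \<tau> t \<and> \<tau> t < 1" if "t < n\<^sup>2" for t using \<sigma>[OF rb(1,2)[OF that]] rb(3)[OF that] by simp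
  have on: "g (\<tau> t) \<in> r t" "g (\<tau> t) \<in> b t" if "t < n\<^sup>2" for t
    using \<sigma>[OF rb(1,2)[OF that]] rb(3)[OF that] by auto
  have injrb: "inj_on (\<lambda>t. (r t, b t)) {..<n\<^sup>2}"
  proof (rule inj_onI)
    fix s t assume st: "s \<in> {..<n\<^sup>2}" "t \<in> {..<n\<^sup>2}" "(r s, b s) = (r t, b t)"
    then have "\<tau> s = \<tau> t" using rb(3)[of s] rb(3)[of t] by simp
    then show "s = t" using \<tau>_mono[of s t] \<tau>_mono[of t s] st by (metis lessThan_iff linorder_neqE_nat less_irrefl)
  qed
  have red: "card {t \<in> {..<n\<^sup>2}. r t = X \<and> Y \<in> seen_since r t} \<le> 2 * card (X \<inter> Y) + 4"
    if XY: "X \<in> S1" "Y \<in> S1" "X \<noteq> Y" for X Y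
  proof (rule alternations_le_intersections[OF g(1,2) sides(2) D(3)[OF XY(1)] S1out[OF XY(1)]
        D(3)[OF XY(2)] S1out[OF XY(2)] XY(3)])
    show "finite (X \<inter> Y)" using D(6) XY by blast
    \<comment> \<open>The point at position \<open>t\<close> also lies on a curve of
      \<open>S2\<close>, so it cannot lie on two curves of \<open>S1\<close>.\<close>
    have tri: "X \<inter> Y \<inter> b t = {}" if "t < n\<^sup>2" for t
      using D(5)[of X Y "b t"] XY rb(2)[OF that] disj by blast
    show "g (\<tau> t) \<in> X - Y" if "t < n\<^sup>2" "r t = X" for t using on[OF that(1)] tri[OF that(1)] that(2) by blast
    show "g (\<tau> t) \<in> Y - X" if "t < n\<^sup>2" "r t = Y" for t using on[OF that(1)] tri[OF that(1)] that(2) by blast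
  qed (use \<tau>_mono \<tau>01 in auto)
  have blue: "card {t \<in> {..<n\<^sup>2}. b t = X \<and> Y \<in> seen_since b t} \<le> 2 * card (X \<inter> Y) + 4"
    if XY: "X \<in> S2" "Y \<in> S2" "X \<noteq> Y" for X Y
  proof (rule alternations_le_intersections[OF g(1,2) sides(1) D(4)[OF XY(1)] G(2)[OF XY(1)]
        D(4)[OF XY(2)] G(2)[OF XY(2)] XY(3)])
    show "finite (X \<inter> Y)" using D(6) XY by blast
    have tri: "X \<inter> Y \<inter> r t = {}" if "t < n\<^sup>2" for t
      using D(5)[of X Y "r t"] XY rb(1)[OF that] disj by blast
    show "g (\<tau> t) \<in> X - Y" if "t < n\<^sup>2" "b t = X" for t using on[OF that(1)] tri[OF that(1)] that(2) by blast
    show "g (\<tau> t) \<in> Y - X" if "t < n\<^sup>2" "b t = Y" for t using on[OF that(1)] tri[OF that(1)] that(2) by blast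
  qed (use \<tau>_mono \<tau>01 in auto)
  have total: "(\<Sum>t<n\<^sup>2. card (seen_since c t)) \<le> 2 * pair_count S + 4 * n\<^sup>2"
    if S: "finite S" "card S = n" "\<And>t. t < n\<^sup>2 \<Longrightarrow> c t \<in> S"
      and le: "\<And>X Y. X \<in> S \<Longrightarrow> Y \<in> S \<Longrightarrow> X \<noteq> Y \<Longrightarrow>
        card {t \<in> {..<n\<^sup>2}. c t = X \<and> Y \<in> seen_since c t} \<le> 2 * card (X \<inter> Y) + 4"
    for S and c :: "nat \<Rightarrow> complex set"
  proof -
    have "(\<Sum>t<n\<^sup>2. card (seen_since c t))
        = (\<Sum>X\<in>S. \<Sum>Y\<in>S - {X}. card {t \<in> {..<n\<^sup>2}. c t = X \<and> Y \<in> seen_since c t})"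
      by (rule sum_card_seen_since_by_pairs[OF S(1,3)])
    also have "\<dots> \<le> (\<Sum>X\<in>S. \<Sum>Y\<in>S - {X}. 2 * card (X \<inter> Y) + 4)"
      using le by (intro sum_mono) auto
    also have "\<dots> = 2 * pair_count S + (\<Sum>X\<in>S. 4 * card (S - {X}))"
      by (simp add: pair_count_def sum.distrib sum_distrib_left mult.commute)
    also have "(\<Sum>X\<in>S. 4 * card (S - {X})) \<le> (\<Sum>X\<in>S. 4 * n)"
      using S(1,2) card_Diff1_le[of S] by (intro sum_mono) auto
    also have "\<dots> = 4 * n\<^sup>2" using S(2) by (simp add: power2_eq_square)
    finally show ?thesis by simp
  qed
  have "real (n\<^sup>2) / 8 * ln (real n / 2)
      \<le> real ((\<Sum>t<n\<^sup>2. card (seen_since r t)) + (\<Sum>t<n\<^sup>2. card (seen_since b t)))"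
    by (rule sum_seen_since_ge[OF injrb n(3)])
  also have "\<dots> \<le> real ((2 * pair_count S1 + 4 * n\<^sup>2) + (2 * pair_count S2 + 4 * n\<^sup>2))"
    unfolding of_nat_le_iff
    using total[OF D(1) n(1) rb(1) red] total[OF D(2) n(2) rb(2) blue] by (rule add_mono)
  finally show ?thesis by simp
qed

section \<open>Reduction to the inside by an inversion\<close>

text \<open>The curve is the frontier of its inside, so every open subset of the curve that is not
  empty would meet the inside.\<close>

lemma interior_closed_curve: "closed_curve A \<Longrightarrow> interior A = {}"
proof (rule ccontr)
  assume A: "closed_curve A" and ne: "interior A \<noteq> {}"
  have "A \<subseteq> closure (inside A)"
    using closed_curve_Jordan(8)[OF A] by (metis Diff_subset frontier_def)
  then have "interior A \<inter> closure (inside A) \<noteq> {}" using ne interior_subset[of A] by blast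
  then have "interior A \<inter> inside A \<noteq> {}" by (simp add: open_Int_closure_eq_empty)
  then show False using interior_subset[of A] inside_no_overlap[of A] by blast
qed

text \<open>Finitely many curves cover no nonempty open set; this provides a centre of inversion off
  all curves.\<close>

lemma interior_Union_closed_curves:
  assumes "finite S" "\<And>A. A \<in> S \<Longrightarrow> closed_curve A"
  shows "interior (\<Union>S) = {}"
  using assms
proof (induction S rule: finite_induct)
  case (insert A S)
  then have "interior (\<Union>S) = {}" by simp
  then show ?case
    using interior_closed_Un_empty_interior[of A "\<Union>S"] interior_closed_curve[of A]
      closed_curve_closed[of A] insert.prems by simp
qed simp

text \<open>Injectivity preserves all intersection conditions, and the centre lies off the curves,
  so their images are closed curves again.\<close>

lemma touching_families_inversion:
  assumes tf: "touching_families S1 S2" and a: "a \<notin> \<Union>(S1 \<union> S2)"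
  defines "F \<equiv> image (\<lambda>z::complex. inverse (z - a))"
  shows "touching_families (F ` S1) (F ` S2)"
proof -
  note D = touching_familiesD[OF tf]
  have Int: "F A \<inter> F B = F (A \<inter> B)" for A B
    unfolding F_def by (rule image_Int[OF inj_inversion, symmetric])
  have F_empty: "F A = {} \<longleftrightarrow> A = {}" for A by (simp add: F_def)
  have cc: "closed_curve (F A)" if "A \<in> S1 \<union> S2" for A
  proof -
    have "a \<notin> A" using a that by blast
    moreover have "closed_curve A" using D(3,4) that by blast
    ultimately show ?thesis unfolding F_def by (rule closed_curve_inversion[rotated])
  qed
  have gp: "general_position (F ` (S1 \<union> S2))"
    unfolding general_position_def
  proof (intro conjI ballI impI)
    fix A' B' C' assume "A' \<in> F ` (S1 \<union> S2)" "B' \<in> F ` (S1 \<union> S2)" "C' \<in> F ` (S1 \<union> S2)"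
      and neq: "A' \<noteq> B' \<and> A' \<noteq> C' \<and> B' \<noteq> C'"
    then obtain A B C where ABC: "A \<in> S1 \<union> S2" "A' = F A" "B \<in> S1 \<union> S2" "B' = F B"
      "C \<in> S1 \<union> S2" "C' = F C" by blast
    then have "A \<inter> B \<inter> C = {}" using neq by (intro D(5)) auto
    then show "A' \<inter> B' \<inter> C' = {}" unfolding ABC Int by (simp add: F_def)
  next
    fix A' B' assume "A' \<in> F ` (S1 \<union> S2)" "B' \<in> F ` (S1 \<union> S2)" and neq: "A' \<noteq> B'"
    then obtain A B where AB: "A \<in> S1 \<union> S2" "A' = F A" "B \<in> S1 \<union> S2" "B' = F B" by blast
    then have "finite (A \<inter> B)" using neq by (intro D(6)) auto
    then show "finite (A' \<inter> B')" unfolding AB Int by (simp add: F_def)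
  qed
  have meets: "\<forall>A'\<in>F ` (S1 \<union> S2). \<forall>B'\<in>F ` (S1 \<union> S2). A' \<inter> B' \<noteq> {}"
    using D(7) by (auto simp: Int F_empty)
  have tch: "\<forall>A'\<in>F ` S1. \<forall>B'\<in>F ` S2. \<exists>p. A' \<inter> B' = {p}"
  proof (intro ballI)
    fix A' B' assume "A' \<in> F ` S1" "B' \<in> F ` S2"
    then obtain A B where AB: "A \<in> S1" "A' = F A" "B \<in> S2" "B' = F B" by blast
    then obtain p where "A \<inter> B = {p}" using D(8) by blast
    then show "\<exists>p. A' \<inter> B' = {p}" unfolding AB Int by (simp add: F_def)
  qed
  show ?thesis
    unfolding touching_families_def image_Un[symmetric]
    by (intro conjI gp meets tch) (use D(1,2) cc in auto)
qed

lemma inj_image_inversion: "inj (image (\<lambda>z::complex. inverse (z - a)))"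
  by (rule injI) (simp add: inj_image_eq_iff[OF inj_inversion])

lemma card_Int_inversion:
  "card ((\<lambda>z. inverse (z - a)) ` A \<inter> (\<lambda>z. inverse (z - a)) ` B) = card (A \<inter> B)" for a :: complex
  by (simp add: image_Int[OF inj_inversion, symmetric] card_image inj_on_subset[OF inj_inversion])

lemma pair_count_inversion:
  "pair_count (image (\<lambda>z::complex. inverse (z - a)) ` S) = pair_count S"
proof -
  let ?F = "image (\<lambda>z::complex. inverse (z - a))"
  have inj: "inj_on ?F T" for T by (rule inj_on_subset[OF inj_image_inversion]) simp
  have diff: "?F ` S - {?F X} = ?F ` (S - {X})" for X
    using image_set_diff[OF inj_image_inversion[of a], of S "{X}"] by simp
  show ?thesis
    unfolding pair_count_def sum.reindex[OF inj] o_def diff card_Int_inversion ..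
qed

text \<open>Five curves cannot pairwise meet in single points, so for \<open>n \<ge> 5\<close> two
  curves of \<open>S1\<close> share at least two points. All of \<open>S2\<close> is on one side of
  the first of them. If that is the outer side, an inversion makes it the inner side without
  changing any intersection number.\<close>

theorem pair_count_lower_bound:
  assumes tf: "touching_families S1 S2" and n: "card S1 = n" "card S2 = n" "n \<ge> 5"
  shows "real (n\<^sup>2) / 8 * ln (real n / 2) \<le> real (2 * pair_count S1 + 2 * pair_count S2 + 8 * n\<^sup>2)"
proof -
  note D = touching_familiesD[OF tf]
  have disj: "S1 \<inter> S2 = {}" using touching_families_disjoint[OF tf] .
  have "\<exists>X0 X1. X0 \<in> S1 \<and> X1 \<in> S1 \<and> X0 \<noteq> X1 \<and> card (X0 \<inter> X1) \<ge> 2"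
  proof (rule ccontr)
    assume no: "\<not> ?thesis"
    have single: "\<exists>p. X \<inter> Y = {p}" if XY: "X \<in> S1" "Y \<in> S1" "X \<noteq> Y" for X Y
    proof -
      have "card (X \<inter> Y) < 2" using no XY by (meson not_le)
      moreover have "card (X \<inter> Y) > 0" using D(6,7)[of X Y] XY by (simp add: card_gt_0_iff)
      ultimately have "card (X \<inter> Y) = 1" by linarith
      then show ?thesis by (metis card_1_singletonE)
    qed
    have triple: "X \<inter> Y \<inter> Z = {}" if "X \<in> S1" "Y \<in> S1" "Z \<in> S1" "X \<noteq> Y" "X \<noteq> Z" "Y \<noteq> Z" for X Y Z
      using D(5)[of X Y Z] that by blast
    obtain xs where xs: "set xs = S1" "distinct xs" using finite_distinct_list[OF D(1)] by blast
    define ys where "ys = take 5 xs"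
    have "length ys = 5" using n distinct_card[OF xs(2)] xs(1) by (simp add: ys_def)
    then obtain A B C D' E where ys: "ys = [A, B, C, D', E]"
      by (auto simp: eval_nat_numeral length_Suc_conv)
    then have "distinct [A, B, C, D', E]" using distinct_take[OF xs(2), of 5] by (simp add: ys_def)
    moreover have "{A, B, C, D', E} \<subseteq> S1"
      using set_take_subset[of 5 xs] xs(1) ys by (simp add: ys_def)
    ultimately show False
      by (intro five_touching_curves[of S1 A B C D' E]) (simp_all add: D(3) single triple)
  qed
  then obtain X0 X1 where X01: "X0 \<in> S1" "X1 \<in> S1" "X0 \<noteq> X1" "card (X0 \<inter> X1) \<ge> 2" by blast
  have "\<exists>K\<in>closed_sides X0. \<forall>B\<in>S2. B \<subseteq> K"
  proof (rule all_on_one_side)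
    show "\<exists>p. X0 \<inter> B \<subseteq> {p}" if "B \<in> S2" for B using D(8)[OF X01(1) that] by blast
    show "B \<inter> C \<noteq> {} \<and> X0 \<inter> B \<inter> C = {}" if "B \<in> S2" "C \<in> S2" "B \<noteq> C" for B C
      using D(5)[of X0 B C] D(7)[of B C] that X01(1) disj by blast
  qed (use D X01 in auto)
  then consider "\<forall>B\<in>S2. B \<subseteq> X0 \<union> inside X0" | "\<forall>B\<in>S2. B \<subseteq> X0 \<union> outside X0"
    unfolding closed_sides_def by auto
  then show ?thesis
  proof cases
    case 1
    then show ?thesis using pair_count_lower_bound_inside[OF tf n(1,2) _ X01] n(3) by simp
  next
    case 2
    have cc0: "closed_curve X0" using D(3) X01(1) .
    have "interior (\<Union>(S1 \<union> S2)) = {}"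
      by (rule interior_Union_closed_curves) (use D in auto)
    then have "\<not> inside X0 \<subseteq> \<Union>(S1 \<union> S2)"
      using interior_maximal[OF _ closed_curve_Jordan(3)[OF cc0]] closed_curve_Jordan(7)[OF cc0] by blast
    then obtain a where a: "a \<in> inside X0" "a \<notin> \<Union>(S1 \<union> S2)" by blast
    define F where "F = image (\<lambda>z::complex. inverse (z - a))"
    note tf' = touching_families_inversion[OF tf a(2), folded F_def]
    have injF: "inj F" unfolding F_def by (rule inj_image_inversion)
    have card: "card (F ` S) = card S" for S by (simp add: card_image inj_on_subset[OF injF])
    have pc: "pair_count (F ` S) = pair_count S" for S unfolding F_def by (rule pair_count_inversion)
    have out: "F (outside X0) \<subseteq> inside (F X0)"
      unfolding F_def by (rule inversion_outside[OF cc0 a(1)])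
    have "real (n\<^sup>2) / 8 * ln (real n / 2)
        \<le> real (2 * pair_count (F ` S1) + 2 * pair_count (F ` S2) + 8 * n\<^sup>2)"
    proof (rule pair_count_lower_bound_inside[OF tf'])
      show "F X0 \<in> F ` S1" "F X1 \<in> F ` S1" using X01 by auto
      show "F X0 \<noteq> F X1" using X01(3) injF by (simp add: inj_eq)
      show "2 \<le> card (F X0 \<inter> F X1)" using X01(4) unfolding F_def card_Int_inversion .
      show "B' \<subseteq> F X0 \<union> inside (F X0)" if "B' \<in> F ` S2" for B'
      proof -
        obtain B where B: "B \<in> S2" "B' = F B" using \<open>B' \<in> F ` S2\<close> by blast
        then have "B' \<subseteq> F (X0 \<union> outside X0)" using 2 unfolding F_def by blast
        then show ?thesis using out unfolding F_def by blast
      qed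
    qed (use n card in auto)
    then show ?thesis unfolding pc .
  qed
qed

section \<open>From intersection points to crossing points\<close>

text \<open>A pair of curves has at most one touching point, which accounts for the square. A
  crossing point lies on at most two curves, so the ordered pairs count it at most twice.\<close>

lemma pair_count_le_crossings:
  assumes S: "finite S" "general_position S"
  shows "pair_count S \<le> 2 * card (crossings S) + (card S)\<^sup>2"
proof -
  note gp = S(2)[unfolded general_position_def]
  have tri: "A \<inter> B \<inter> C = {}" if "A \<in> S" "B \<in> S" "C \<in> S" "A \<noteq> B" "A \<noteq> C" "B \<noteq> C" for A B C
    using gp[THEN conjunct1, rule_format, OF that(1-3)] that(4-6) by simp
  have fin: "finite (A \<inter> B)" if "A \<in> S" "B \<in> S" "A \<noteq> B" for A B
    using gp[THEN conjunct2, rule_format, OF that] .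
  have fin_cp: "finite (crossing_points A B)" if "A \<in> S" "B \<in> S" "A \<noteq> B" for A B
    using fin[OF that] by (simp add: crossing_points_def)
  have fin_cr: "finite (crossings S)" unfolding crossings_def using S(1) fin_cp by blast
  have card_Int: "card (A \<inter> B) \<le> card (crossing_points A B) + 1" if "A \<in> S" "B \<in> S" "A \<noteq> B" for A B
  proof (cases "touching_points A B = {}")
    case True
    then show ?thesis by (simp add: crossing_points_def)
  next
    case False
    then obtain p where "A \<inter> B = {p}" by (auto simp: touching_points_def)
    then show ?thesis by simp
  qed
  have "pair_count S \<le> (\<Sum>A\<in>S. \<Sum>B\<in>S - {A}. card (crossing_points A B) + 1)"
    unfolding pair_count_def using card_Int by (intro sum_mono) auto
  also have "\<dots> = (\<Sum>A\<in>S. \<Sum>B\<in>S - {A}. card (crossing_points A B)) + (\<Sum>A\<in>S. card (S - {A}))"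
    by (simp only: sum.distrib card_eq_sum)
  also have "(\<Sum>A\<in>S. card (S - {A})) \<le> (\<Sum>A\<in>S. card S)"
    by (rule sum_mono) (rule card_Diff1_le)
  also have "\<dots> = (card S)\<^sup>2" by (simp add: power2_eq_square)
  also have "(\<Sum>A\<in>S. \<Sum>B\<in>S - {A}. card (crossing_points A B)) \<le> (\<Sum>A\<in>S. card {p \<in> crossings S. p \<in> A})"
  proof (rule sum_mono)
    fix A assume A: "A \<in> S"
    \<comment> \<open>For fixed \<open>A\<close>, a point common to the crossing sets of two curves
      would be a triple point, so these sets are disjoint.\<close>
    have "(\<Sum>B\<in>S - {A}. card (crossing_points A B)) = card (\<Union>B\<in>S - {A}. crossing_points A B)"
    proof (rule card_UN_disjoint[symmetric])
      show "\<forall>B\<in>S - {A}. \<forall>C\<in>S - {A}. B \<noteq> C \<longrightarrow> crossing_points A B \<inter> crossing_points A C = {}"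
      proof (intro ballI impI)
        fix B C assume "B \<in> S - {A}" "C \<in> S - {A}" "B \<noteq> C"
        then have "A \<inter> B \<inter> C = {}" using tri[of A B C] A by blast
        then show "crossing_points A B \<inter> crossing_points A C = {}" unfolding crossing_points_def by blast
      qed
    qed (use S(1) fin_cp A in auto)
    also have "\<dots> \<le> card {p \<in> crossings S. p \<in> A}"
    proof (rule card_mono)
      show "(\<Union>B\<in>S - {A}. crossing_points A B) \<subseteq> {p \<in> crossings S. p \<in> A}"
        using A unfolding crossings_def by (auto simp: crossing_points_def)
    qed (use fin_cr in simp)
    finally show "(\<Sum>B\<in>S - {A}. card (crossing_points A B)) \<le> card {p \<in> crossings S. p \<in> A}" .
  qed
  also have "\<dots> = (\<Sum>A\<in>S. \<Sum>p\<in>crossings S. if p \<in> A then 1 else 0)"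
    using fin_cr by (simp add: sum.If_cases Int_def)
  also have "\<dots> = (\<Sum>p\<in>crossings S. \<Sum>A\<in>S. if p \<in> A then 1 else 0)" by (rule sum.swap)
  also have "\<dots> = (\<Sum>p\<in>crossings S. card {A \<in> S. p \<in> A})"
    using S(1) by (simp add: sum.If_cases Int_def)
  also have "\<dots> \<le> (\<Sum>p\<in>crossings S. 2)"
  proof (rule sum_mono)
    fix p
    show "card {A \<in> S. p \<in> A} \<le> 2"
    proof (rule ccontr)
      assume "\<not> ?thesis"
      then have "3 \<le> card {A \<in> S. p \<in> A}" by simp
      then obtain T where T: "T \<subseteq> {A \<in> S. p \<in> A}" "card T = 3"
        using obtain_subset_with_card_n by metis
      then obtain A B C where "T = {A, B, C}" "A \<noteq> B" "A \<noteq> C" "B \<noteq> C"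
        by (auto simp: card_3_iff)
      then show False using tri[of A B C] T(1) by blast
    qed
  qed
  finally show ?thesis by simp
qed

theorem theorem7:
  "\<exists>c::real. c > 0 \<and>
     (\<forall>\<^sub>F n::nat in sequentially. \<forall>S1 S2 :: complex set set.
        finite S1 \<and> finite S2 \<and>
        (\<forall>A \<in> S1 \<union> S2. closed_curve A) \<and>
        general_position (S1 \<union> S2) \<and>
        card S1 = n \<and> card S2 = n \<and>
        (\<forall>A \<in> S1 \<union> S2. \<forall>B \<in> S1 \<union> S2. A \<inter> B \<noteq> {}) \<and>
        (\<forall>A \<in> S1. \<forall>B \<in> S2. touch A B)
        \<longrightarrow>
        real (card (crossings S1)) \<ge> c * (real n)\<^sup>2 * sqrt (ln (real n) / ln (ln (real n))) \<or>
        real (card (crossings S2)) \<ge> c * (real n)\<^sup>2 * sqrt (ln (real n) / ln (ln (real n))))"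
proof (intro exI[of _ 1] conjI)
  \<comment> \<open>The constant 1 works because a bound of order n^2 log n eventually dominates.
    Each \<open>2 * pair_count\<close> costs 4 times the crossings plus 2 n^2; this gives 8 = 4 + 4
    and 12 = 8 + 2 + 2.\<close>
  have "\<forall>\<^sub>F n::nat in sequentially. ln (real n / 2) / 8 \<ge> 8 * sqrt (ln (real n) / ln (ln (real n))) + 12"
    by real_asymp
  moreover have "\<forall>\<^sub>F n::nat in sequentially. n \<ge> 5" by (rule eventually_ge_at_top)
  ultimately show "\<forall>\<^sub>F n::nat in sequentially. \<forall>S1 S2 :: complex set set.
        finite S1 \<and> finite S2 \<and>
        (\<forall>A \<in> S1 \<union> S2. closed_curve A) \<and>
        general_position (S1 \<union> S2) \<and>
        card S1 = n \<and> card S2 = n \<and>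
        (\<forall>A \<in> S1 \<union> S2. \<forall>B \<in> S1 \<union> S2. A \<inter> B \<noteq> {}) \<and>
        (\<forall>A \<in> S1. \<forall>B \<in> S2. touch A B)
        \<longrightarrow>
        real (card (crossings S1)) \<ge> 1 * (real n)\<^sup>2 * sqrt (ln (real n) / ln (ln (real n))) \<or>
        real (card (crossings S2)) \<ge> 1 * (real n)\<^sup>2 * sqrt (ln (real n) / ln (ln (real n)))"
  proof eventually_elim
    case (elim n)
    define q where "q = sqrt (ln (real n) / ln (ln (real n)))"
    show ?case
    proof (intro allI impI, rule ccontr, elim conjE)
      fix S1 S2 :: "complex set set"
      assume S: "finite S1" "finite S2" "\<forall>A \<in> S1 \<union> S2. closed_curve A"
        "general_position (S1 \<union> S2)" "card S1 = n" "card S2 = n"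
        "\<forall>A \<in> S1 \<union> S2. \<forall>B \<in> S1 \<union> S2. A \<inter> B \<noteq> {}" "\<forall>A \<in> S1. \<forall>B \<in> S2. touch A B"
      assume neg: "\<not> (real (card (crossings S1)) \<ge> 1 * (real n)\<^sup>2 * sqrt (ln (real n) / ln (ln (real n))) \<or>
        real (card (crossings S2)) \<ge> 1 * (real n)\<^sup>2 * sqrt (ln (real n) / ln (ln (real n))))"
      have "\<forall>A \<in> S1. \<forall>B \<in> S2. \<exists>p. A \<inter> B = {p}" using S(8) unfolding touch_def by blast
      then have tf: "touching_families S1 S2" unfolding touching_families_def using S(1-4,7) by simp
      have gp: "general_position S1" "general_position S2"
        using S(4) unfolding general_position_def by simp_all
      have "real (n\<^sup>2) / 8 * ln (real n / 2) \<le> real (2 * pair_count S1 + 2 * pair_count S2 + 8 * n\<^sup>2)"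
        using pair_count_lower_bound[OF tf S(5,6)] elim by simp
      also have "\<dots> \<le> real (4 * card (crossings S1) + 4 * card (crossings S2) + 12 * n\<^sup>2)"
        using pair_count_le_crossings[OF S(1) gp(1)] pair_count_le_crossings[OF S(2) gp(2)] S(5,6)
        unfolding of_nat_le_iff by simp
      also have "\<dots> = 4 * real (card (crossings S1)) + 4 * real (card (crossings S2)) + 12 * (real n)\<^sup>2"
        by simp
      also have "\<dots> < 4 * ((real n)\<^sup>2 * q) + 4 * ((real n)\<^sup>2 * q) + 12 * (real n)\<^sup>2"
      proof -
        have "real (card (crossings S1)) < (real n)\<^sup>2 * q" "real (card (crossings S2)) < (real n)\<^sup>2 * q"
          using neg unfolding q_def[symmetric] by (simp_all add: not_le)
        then show ?thesis by linarith
      qed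
      also have "\<dots> = (real n)\<^sup>2 * (8 * q + 12)" by (simp add: algebra_simps)
      also have "\<dots> \<le> (real n)\<^sup>2 * (ln (real n / 2) / 8)"
        using elim by (intro mult_left_mono) (auto simp: q_def)
      finally show False by (simp add: field_simps)
    qed
  qed
qed simp

end
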